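(* For $\mathcal M_*=[z^2-\sqrt3\,zw+w^2]$, $$\Sigma_4(\mathcal M_* )-\Sigma_3(\mathcal M_* )>\frac{13}{75000}>0 .$$ Thus the sequence $(\Sigma_k([p]))_{k\ge0}$ need not be decreasing, even for a quadratic homogeneous polynomial $p$.
   Context: $H^2(\mathbb D^2)$ is the Hardy space of the bidisc; $[p]$ is the closure of $p\,\mathbb C[z,w]$ in it; $m$ is normalized Haar measure on $\mathbb T$. For $p\ne0$ homogeneous put $q(\zeta)=p(\zeta,1)$ and $d\mu=\frac{|q|^2}{\|q\|_2^2}dm$ on $\mathbb T$ ($\|q\|_2$ the $L^2(\mathbb T,m)$ norm). Let $(\varphi_n)_{n\ge0}$ be the orthonormal polynomials of $\mu$ with positive leading coefficients and $\varphi_n^*(\zeta)=\zeta^n\overline{\varphi_n(1/\overline\zeta)}$. Put $$e_n(z,w)=\frac{p(z,w)}{\|p\|}w^n\varphi_n^*(z/w),\qquad f_n(z,w)=\frac{p(z,w)}{\|p\|}w^n\varphi_n(z/w)\qquad(n\ge0),$$ which are orthonormal bases of $[p]\ominus z[p]$ and $[p]\ominus w[p]$ respectively, and for $k\ge0$ define $$\Sigma_k([p])=\sum_{j,n\ge0}|\langle w^ke_j,z^kf_n\rangle|^2 .$$ *)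

theory Defs
  imports "HOL-Analysis.Analysis" "HOL-Computational_Algebra.Polynomial"
begin

text \<open>
  Elements of the Hardy space of the bidisc are functions of two complex variables of which
  only the values on the open bidisc matter: the Taylor coefficients, and hence the inner
  product and the norm, depend on nothing else.
\<close>

definition bidisc_expansion ::
    "(complex \<Rightarrow> complex \<Rightarrow> complex) \<Rightarrow> (nat \<times> nat \<Rightarrow> complex) \<Rightarrow> bool" where
  "bidisc_expansion F a \<longleftrightarrow>
     (\<forall>z w. norm z < 1 \<longrightarrow> norm w < 1 \<longrightarrow>
        ((\<lambda>(i, j). a (i, j) * z ^ i * w ^ j) has_sum F z w) UNIV)"

definition taylor_coeff :: "(complex \<Rightarrow> complex \<Rightarrow> complex) \<Rightarrow> nat \<times> nat \<Rightarrow> complex" where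
  "taylor_coeff F = (THE a. bidisc_expansion F a)"

definition hardy2 :: "(complex \<Rightarrow> complex \<Rightarrow> complex) set" where
  "hardy2 = {F. \<exists>a. bidisc_expansion F a \<and> (\<lambda>ij. (norm (a ij))\<^sup>2) summable_on UNIV}"

definition hardy_inner ::
    "(complex \<Rightarrow> complex \<Rightarrow> complex) \<Rightarrow> (complex \<Rightarrow> complex \<Rightarrow> complex) \<Rightarrow> complex" where
  "hardy_inner F G = (\<Sum>\<^sub>\<infinity>ij\<in>UNIV. taylor_coeff F ij * cnj (taylor_coeff G ij))"

definition hardy_norm :: "(complex \<Rightarrow> complex \<Rightarrow> complex) \<Rightarrow> real" where
  "hardy_norm F = sqrt (Re (hardy_inner F F))"

definition polys2 :: "(complex \<Rightarrow> complex \<Rightarrow> complex) set" where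
  "polys2 = {g. \<exists>N c. g = (\<lambda>z w. \<Sum>i\<le>N. \<Sum>j\<le>N. c i j * z ^ i * w ^ j)}"

definition homogeneous2 :: "nat \<Rightarrow> (complex \<Rightarrow> complex \<Rightarrow> complex) \<Rightarrow> bool" where
  "homogeneous2 d p \<longleftrightarrow> (\<exists>c. p = (\<lambda>z w. \<Sum>i\<le>d. c i * z ^ i * w ^ (d - i)))"

text \<open>The submodule \<open>[p]\<close>: the closure of \<open>p \<cdot> \<complex>[z,w]\<close> in the Hardy space.\<close>

definition submodule_gen ::
    "(complex \<Rightarrow> complex \<Rightarrow> complex) \<Rightarrow> (complex \<Rightarrow> complex \<Rightarrow> complex) set" where
  "submodule_gen p =
     {F \<in> hardy2. \<forall>\<epsilon>>0. \<exists>g\<in>polys2. hardy_norm (\<lambda>z w. F z w - p z w * g z w) < \<epsilon>}"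

text \<open>Normalized Haar measure of the unit circle, as a Borel measure on the complex plane.\<close>

definition circle_haar :: "complex measure" where
  "circle_haar = distr (uniform_measure lborel {0..2 * pi}) borel cis"

definition circle_measure :: "(complex \<Rightarrow> complex \<Rightarrow> complex) \<Rightarrow> complex measure" where
  "circle_measure p =
     density circle_haar
       (\<lambda>\<zeta>. ennreal ((norm (p \<zeta> 1))\<^sup>2 / (\<integral>\<xi>. (norm (p \<xi> 1))\<^sup>2 \<partial>circle_haar)))"

definition orthonormal_polys :: "complex measure \<Rightarrow> (nat \<Rightarrow> complex poly) \<Rightarrow> bool" where
  "orthonormal_polys \<mu> \<phi> \<longleftrightarrow>
     (\<forall>n. degree (\<phi> n) = n \<and> (\<exists>\<kappa>>0. lead_coeff (\<phi> n) = complex_of_real \<kappa>)) \<and>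
     (\<forall>m n. (\<integral>\<zeta>. poly (\<phi> m) \<zeta> * cnj (poly (\<phi> n) \<zeta>) \<partial>\<mu>) = (if m = n then 1 else 0))"

definition onp :: "complex measure \<Rightarrow> nat \<Rightarrow> complex poly" where
  "onp \<mu> = (THE \<phi>. orthonormal_polys \<mu> \<phi>)"

text \<open>
  For \<open>f\<close> of degree \<open>n\<close>, \<open>poly_star f\<close> is the polynomial \<open>\<zeta>\<^sup>n \<cdot> cnj (f (1 / cnj \<zeta>))\<close>, and
  \<open>homogenize n f\<close> is the form \<open>w\<^sup>n \<cdot> f (z / w)\<close>.  Both are given through coefficients since
  the displayed expressions, read literally, are wrong at \<open>\<zeta> = 0\<close> and \<open>w = 0\<close>
  (division by zero); the two lemmas below show that they agree everywhere else.
\<close>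

definition poly_star :: "complex poly \<Rightarrow> complex poly" where
  "poly_star f = map_poly cnj (reflect_poly f)"

definition homogenize :: "nat \<Rightarrow> complex poly \<Rightarrow> complex \<Rightarrow> complex \<Rightarrow> complex" where
  "homogenize n f z w = (\<Sum>i\<le>n. coeff f i * z ^ i * w ^ (n - i))"

lemma poly_poly_star:
  assumes "\<zeta> \<noteq> 0"
  shows "poly (poly_star f) \<zeta> = \<zeta> ^ degree f * cnj (poly f (1 / cnj \<zeta>))"
proof -
  have "poly (poly_star f) \<zeta> = cnj (poly (reflect_poly f) (cnj \<zeta>))"
    by (simp add: poly_star_def poly_altdef degree_map_poly coeff_map_poly)
  also have "\<dots> = \<zeta> ^ degree f * cnj (poly f (1 / cnj \<zeta>))"
    using assms by (simp add: poly_reflect_poly_nz inverse_eq_divide)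
  finally show ?thesis .
qed

lemma homogenize_eq:
  assumes "degree f \<le> n" "w \<noteq> 0"
  shows "homogenize n f z w = w ^ n * poly f (z / w)"
proof -
  have "poly f (z / w) = (\<Sum>i\<le>n. coeff f i * (z / w) ^ i)"
    unfolding poly_altdef using assms(1)
    by (intro sum.mono_neutral_left) (auto simp: coeff_eq_0)
  then show ?thesis
    using assms(2)
    by (auto simp: homogenize_def sum_distrib_left power_divide power_diff intro!: sum.cong)
qed

definition basis_e ::
    "(complex \<Rightarrow> complex \<Rightarrow> complex) \<Rightarrow> nat \<Rightarrow> complex \<Rightarrow> complex \<Rightarrow> complex" where
  "basis_e p n z w =
     p z w / of_real (hardy_norm p) * homogenize n (poly_star (onp (circle_measure p) n)) z w"

definition basis_f ::
    "(complex \<Rightarrow> complex \<Rightarrow> complex) \<Rightarrow> nat \<Rightarrow> complex \<Rightarrow> complex \<Rightarrow> complex" where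
  "basis_f p n z w =
     p z w / of_real (hardy_norm p) * homogenize n (onp (circle_measure p) n) z w"

definition Sigma_gen :: "(complex \<Rightarrow> complex \<Rightarrow> complex) \<Rightarrow> nat \<Rightarrow> ennreal" where
  "Sigma_gen p k =
     (\<Sum>\<^sub>\<infinity>(j, n)\<in>UNIV. ennreal
        ((norm (hardy_inner (\<lambda>z w. w ^ k * basis_e p j z w) (\<lambda>z w. z ^ k * basis_f p n z w)))\<^sup>2))"

text \<open>
  \<open>Sigma_sub M k\<close> is \<open>\<Sigma>\<^sub>k(M)\<close> for a submodule \<open>M = [p]\<close> with a nonzero homogeneous generator
  \<open>p\<close>.  Such a \<open>p\<close> is determined by \<open>M\<close> up to a nonzero constant factor, which changes all
  \<open>e\<^sub>n\<close> and \<open>f\<^sub>n\<close> by one common unimodular factor and so does not affect \<open>\<Sigma>\<^sub>k\<close>.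
\<close>

definition Sigma_sub :: "(complex \<Rightarrow> complex \<Rightarrow> complex) set \<Rightarrow> nat \<Rightarrow> ennreal" where
  "Sigma_sub M k =
     (THE s. \<exists>d p. homogeneous2 d p \<and> p \<noteq> (\<lambda>z w. 0) \<and> M = submodule_gen p \<and> s = Sigma_gen p k)"

definition M_star :: "(complex \<Rightarrow> complex \<Rightarrow> complex) set" where
  "M_star = submodule_gen (\<lambda>z w. z\<^sup>2 - of_real (sqrt 3) * z * w + w\<^sup>2)"

end

theory Submission
  imports Defs "HOL-Complex_Analysis.Cauchy_Integral_Formula" "HOL-Probability.Probability_Measure"
begin

text \<open>
  Write the generator as \<open>z\<^sup>2 - 2 cos t z w + w\<^sup>2\<close> with \<open>t = \<pi> / 6\<close>, so that \<open>q = (\<zeta> - a) (\<zeta> - cnj a)\<close>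
  with \<open>a = cis t\<close>.  Multiplied by \<open>q\<close>, the monic orthogonal polynomial of degree \<open>n\<close> becomes \<open>\<zeta>\<^sup>m\<close>, \<open>m = n + 2\<close>, plus a
  combination of the Szego kernels of degree below \<open>m\<close> at \<open>a\<close> and \<open>cnj a\<close>, fixed by vanishing at these two points.
  Only the terms \<open>j = n\<close> of \<open>\<Sigma>\<^sub>k\<close> survive, and they are self-convolutions of the coefficients of this polynomial.  Since \<open>a\<close> is
  a root of unity, the squares of these terms are rational functions of \<open>m\<close> on each residue class modulo 6.  The
  difference \<open>\<Sigma>\<^sub>4 - \<Sigma>\<^sub>3\<close> is then bounded below by its first terms plus a telescoping minorant of the tail.  A homogeneous
  generator is determined up to a constant by the lowest homogeneous components of its submodule.
\<close>

subsection \<open>Power series on the bidisc\<close>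

text \<open>Why Szego kernels: pairing a polynomial of degree below \<open>m\<close> with the kernel
  at a point evaluates it there. The polynomials of degree below \<open>m\<close> orthogonal to all
  multiples of \<open>q\<close> thus form a plane spanned by the kernels at the two zeros. Vanishing
  at both zeros is a 2 by 2 system whose Gram determinant is elementary, which gives closed forms
  without any recurrence. Off-diagonal terms drop out because homogeneous forms of different degree
  are orthogonal. The numerical obstacle is slow decay: the squared matrix elements are only of
  order 1/m^2, while the gap to be certified is of order 10^-4, so bounding the tail by absolute
  values would need thousands of explicit terms. The 1/m^2 coefficients of the difference sum to
  zero over a period of six; a minorant that telescopes keeps this cancellation and, cut at a
  multiple of 6, loses only a quantity of order 1/m^3. Sixteen explicit terms then suffice. Taylor
  coefficients, orthonormal polynomials and \<open>Sigma_sub\<close> are definite descriptions,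
  hence the three uniqueness results.\<close>

lemma powser_eq_0_imp_coeff_eq_0:
  fixes a :: "nat \<Rightarrow> complex"
  assumes "\<And>x. norm x < 1 \<Longrightarrow> (\<lambda>n. a n * x ^ n) sums 0"
  shows "a n = 0"
proof (rule ccontr)
  assume an: "a n \<noteq> 0"
  have "a 0 = 0" using assms[of 0] by simp
  with an have "n > 0" by (metis gr0I)
  have sums: "(\<lambda>n. a n * (x - 0) ^ n) sums 0" if "norm (x - 0) < 1" for x
    using assms that by simp
  show False
  proof (rule powser_0_nonzero[OF zero_less_one sums refl an \<open>n > 0\<close>])
    fix s :: real assume s: "s > 0" "\<And>z. z \<in> cball (0::complex) s - {0} \<Longrightarrow> (0::complex) \<noteq> 0"
    have "complex_of_real s \<in> cball 0 s - {0}" using s(1) by simp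
    with s(2) show False by blast
  qed
qed

text \<open>The identity theorem is used once in each variable: for fixed \<open>w\<close> the row
  sums are the coefficients of a vanishing power series in \<open>z\<close>, and then each row is
  itself a vanishing power series in \<open>w\<close>.\<close>

lemma bidisc_expansion_zero_imp_eq_0:
  assumes "bidisc_expansion (\<lambda>_ _. 0) a"
  shows "a (i, j) = 0"
proof -
  have row: "(\<Sum>\<^sub>\<infinity>j. a (i, j) * w ^ j) = 0 \<and> ((\<lambda>j. a (i, j) * w ^ j) summable_on UNIV)"
    if w: "norm w < 1" for w and i
  proof -
    have hs: "((\<lambda>(i, j). a (i, j) * z ^ i * w ^ j) has_sum 0) (UNIV \<times> UNIV)" if "norm z < 1" for z
      using assms w that unfolding bidisc_expansion_def by simp
    have sm: "(\<lambda>j. a (i, j) * w ^ j) summable_on UNIV" for i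
    proof -
      \<comment> \<open>Any nonzero \<open>z\<close> in the disc serves here: the row is recovered
        from the double sum by dividing out \<open>z ^ i\<close>.\<close>
      have "(\<lambda>(i, j). a (i, j) * (1/2) ^ i * w ^ j) summable_on (UNIV \<times> UNIV)"
        using hs[of "1/2"] by (auto simp: summable_on_def)
      then have "(\<lambda>j. a (i, j) * (1/2) ^ i * w ^ j) summable_on UNIV"
        using summable_on_SigmaD1[of "\<lambda>i j. a (i, j) * (1/2) ^ i * w ^ j" UNIV "\<lambda>_. UNIV" i]
        by simp
      then have "(\<lambda>j. 2 ^ i * (a (i, j) * (1/2) ^ i * w ^ j)) summable_on UNIV"
        by (rule summable_on_cmult_right)
      then show ?thesis by (simp add: power_divide mult_ac)
    qed
    define b where "b = (\<lambda>i. \<Sum>\<^sub>\<infinity>j. a (i, j) * w ^ j)"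
    have "b i = 0"
    proof (rule powser_eq_0_imp_coeff_eq_0)
      fix z :: complex assume z: "norm z < 1"
      have "((\<lambda>i. b i * z ^ i) has_sum 0) UNIV"
      proof (rule has_sum_SigmaD[OF hs[OF z]])
        fix i :: nat
        have "((\<lambda>j. z ^ i * (a (i, j) * w ^ j)) has_sum (z ^ i * b i)) UNIV"
          unfolding b_def using sm[of i] by (intro has_sum_cmult_right) auto
        then show "((\<lambda>y. case (i, y) of (i, j) \<Rightarrow> a (i, j) * z ^ i * w ^ j) has_sum b i * z ^ i) UNIV"
          by (simp add: mult_ac)
      qed
      then show "(\<lambda>i. b i * z ^ i) sums 0" by (rule has_sum_imp_sums)
    qed
    with sm show ?thesis unfolding b_def by blast
  qed
  show ?thesis
  proof (rule powser_eq_0_imp_coeff_eq_0)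
    fix w :: complex assume "norm w < 1"
    from row[OF this, of i] have "((\<lambda>j. a (i, j) * w ^ j) has_sum 0) UNIV"
      by (metis has_sum_infsum)
    then show "(\<lambda>j. a (i, j) * w ^ j) sums 0" by (rule has_sum_imp_sums)
  qed
qed

lemma bidisc_expansion_add:
  assumes "bidisc_expansion F a" "bidisc_expansion G b"
  shows "bidisc_expansion (\<lambda>z w. F z w + G z w) (\<lambda>ij. a ij + b ij)"
  unfolding bidisc_expansion_def
proof (intro allI impI)
  fix z w :: complex assume zw: "norm z < 1" "norm w < 1"
  have "((\<lambda>x. (case x of (i, j) \<Rightarrow> a (i, j) * z ^ i * w ^ j) + (case x of (i, j) \<Rightarrow> b (i, j) * z ^ i * w ^ j))
      has_sum F z w + G z w) UNIV"
    using assms zw unfolding bidisc_expansion_def by (intro has_sum_add) auto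
  then show "((\<lambda>(i, j). (a (i, j) + b (i, j)) * z ^ i * w ^ j) has_sum F z w + G z w) UNIV"
    by (simp add: case_prod_unfold algebra_simps)
qed

lemma bidisc_expansion_cmult:
  assumes "bidisc_expansion F a"
  shows "bidisc_expansion (\<lambda>z w. c * F z w) (\<lambda>ij. c * a ij)"
  unfolding bidisc_expansion_def
proof (intro allI impI)
  fix z w :: complex assume zw: "norm z < 1" "norm w < 1"
  have "((\<lambda>x. c * (case x of (i, j) \<Rightarrow> a (i, j) * z ^ i * w ^ j)) has_sum c * F z w) UNIV"
    using assms zw unfolding bidisc_expansion_def by (intro has_sum_cmult_right) auto
  then show "((\<lambda>(i, j). c * a (i, j) * z ^ i * w ^ j) has_sum c * F z w) UNIV"
    by (simp add: case_prod_unfold algebra_simps)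
qed

lemma bidisc_expansion_unique:
  assumes "bidisc_expansion F a" "bidisc_expansion F b"
  shows "a = b"
proof
  fix ij :: "nat \<times> nat"
  obtain i j where ij: "ij = (i, j)" by fastforce
  have "bidisc_expansion (\<lambda>_ _. 0) (\<lambda>ij. a ij + (-1) * b ij)"
    using bidisc_expansion_add[OF assms(1) bidisc_expansion_cmult[OF assms(2), of "-1"]] by simp
  from bidisc_expansion_zero_imp_eq_0[OF this, of i j] show "a ij = b ij"
    by (simp add: ij)
qed

lemma taylor_coeff_eq:
  assumes "bidisc_expansion F a"
  shows "taylor_coeff F = a"
  unfolding taylor_coeff_def using assms bidisc_expansion_unique by blast

text \<open>Every function whose inner product has to be computed is a polynomial. Carrying finite
  support along with the expansion turns the infinite sums in \<open>hardy_inner\<close> into finite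
  ones.\<close>

definition finite_expansion where
  "finite_expansion F a \<longleftrightarrow> finite {ij. a ij \<noteq> 0} \<and> bidisc_expansion F a"

lemma finite_expansion_add:
  assumes "finite_expansion F a" "finite_expansion G b"
  shows "finite_expansion (\<lambda>z w. F z w + G z w) (\<lambda>ij. a ij + b ij)"
proof -
  have "{ij. a ij + b ij \<noteq> 0} \<subseteq> {ij. a ij \<noteq> 0} \<union> {ij. b ij \<noteq> 0}" by auto
  then show ?thesis
    using assms bidisc_expansion_add[of F a G b] unfolding finite_expansion_def
    by (meson finite_UnI finite_subset)
qed

lemma finite_expansion_cmult:
  assumes "finite_expansion F a"
  shows "finite_expansion (\<lambda>z w. c * F z w) (\<lambda>ij. c * a ij)"
proof -
  have "{ij. c * a ij \<noteq> 0} \<subseteq> {ij. a ij \<noteq> 0}" by auto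
  then show ?thesis
    using assms bidisc_expansion_cmult[of F a c] unfolding finite_expansion_def
    by (meson finite_subset)
qed

lemma finite_expansion_diff:
  assumes "finite_expansion F a" "finite_expansion G b"
  shows "finite_expansion (\<lambda>z w. F z w - G z w) (\<lambda>ij. a ij - b ij)"
  using finite_expansion_add[OF assms(1) finite_expansion_cmult[OF assms(2), of "-1"]] by simp

lemma finite_expansion_zero: "finite_expansion (\<lambda>_ _. 0) (\<lambda>_. 0)"
  by (simp add: finite_expansion_def bidisc_expansion_def case_prod_unfold)

lemma finite_expansion_sum:
  assumes "finite I" "\<And>i. i \<in> I \<Longrightarrow> finite_expansion (F i) (a i)"
  shows "finite_expansion (\<lambda>z w. \<Sum>i\<in>I. F i z w) (\<lambda>ij. \<Sum>i\<in>I. a i ij)"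
  using assms by (induction I rule: finite_induct) (auto intro: finite_expansion_zero finite_expansion_add)

lemma finite_expansion_one: "finite_expansion (\<lambda>_ _. 1) (\<lambda>ij. if ij = (0, 0) then 1 else 0)"
  unfolding finite_expansion_def bidisc_expansion_def
  by (auto intro!: has_sum_finite_neutralI[of "{(0, 0)}"] split: if_splits)

lemma finite_expansion_shift:
  assumes "finite_expansion F a"
  shows "finite_expansion (\<lambda>z w. z ^ k * w ^ l * F z w)
           (\<lambda>(i, j). if k \<le> i \<and> l \<le> j then a (i - k, j - l) else 0)"
proof -
  define h :: "nat \<times> nat \<Rightarrow> nat \<times> nat" where "h = (\<lambda>(i, j). (i + k, j + l))"
  define b where "b = (\<lambda>(i, j). if k \<le> i \<and> l \<le> j then a (i - k, j - l) else 0)"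
  have inj: "inj h" unfolding h_def by (auto intro!: injI)
  have range: "range h = {(i, j). k \<le> i \<and> l \<le> j}"
  proof -
    have "(i, j) \<in> range h" if "k \<le> i" "l \<le> j" for i j
      using that by (intro image_eqI[of _ _ "(i - k, j - l)"]) (auto simp: h_def)
    then show ?thesis by (auto simp: h_def)
  qed
  have "{ij. b ij \<noteq> 0} \<subseteq> h ` {ij. a ij \<noteq> 0}"
  proof clarify
    fix i j assume "b (i, j) \<noteq> 0"
    then have "k \<le> i" "l \<le> j" "a (i - k, j - l) \<noteq> 0" by (auto simp: b_def split: if_splits)
    then show "(i, j) \<in> h ` {ij. a ij \<noteq> 0}"
      by (intro image_eqI[of _ _ "(i - k, j - l)"]) (auto simp: h_def)
  qed
  moreover have "bidisc_expansion (\<lambda>z w. z ^ k * w ^ l * F z w) b"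
    unfolding bidisc_expansion_def
  proof (intro allI impI)
    fix z w :: complex assume zw: "norm z < 1" "norm w < 1"
    define f where "f = (\<lambda>(i, j). b (i, j) * z ^ i * w ^ j)"
    have "((\<lambda>x. z ^ k * w ^ l * (case x of (i, j) \<Rightarrow> a (i, j) * z ^ i * w ^ j)) has_sum z ^ k * w ^ l * F z w) UNIV"
      using assms zw unfolding bidisc_expansion_def finite_expansion_def by (intro has_sum_cmult_right) auto
    also have "(\<lambda>x. z ^ k * w ^ l * (case x of (i, j) \<Rightarrow> a (i, j) * z ^ i * w ^ j)) = f \<circ> h"
      by (auto simp: fun_eq_iff f_def h_def b_def power_add)
    finally have "(f has_sum z ^ k * w ^ l * F z w) (range h)"
      by (subst has_sum_reindex[OF inj])
    also have "?this \<longleftrightarrow> (f has_sum z ^ k * w ^ l * F z w) UNIV"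
      by (rule has_sum_cong_neutral) (auto simp: range f_def b_def split: if_splits)
    finally show "((\<lambda>(i, j). b (i, j) * z ^ i * w ^ j) has_sum z ^ k * w ^ l * F z w) UNIV"
      by (simp add: f_def)
  qed
  ultimately show ?thesis
    using assms unfolding finite_expansion_def b_def[symmetric] by (meson finite_imageI finite_subset)
qed

lemma finite_expansion_monomial:
  "finite_expansion (\<lambda>z w. c * z ^ k * w ^ l) (\<lambda>ij. if ij = (k, l) then c else 0)"
proof -
  have "(\<lambda>ij. c * (case ij of (i, j) \<Rightarrow> if k \<le> i \<and> l \<le> j then if (i - k, j - l) = (0, 0) then 1 else 0 else 0)) =
        (\<lambda>ij. if ij = (k, l) then c else 0)"
    by (auto simp: fun_eq_iff)
  with finite_expansion_cmult[OF finite_expansion_shift[OF finite_expansion_one, of k l], of c]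
  show ?thesis by (simp add: mult.assoc)
qed

lemma finite_expansion_homogeneous:
  "finite_expansion (\<lambda>z w. \<Sum>i\<le>d. c i * z ^ i * w ^ (d - i)) (\<lambda>(i, j). if i + j = d then c i else 0)"
proof -
  have "(\<lambda>ij. \<Sum>i'\<le>d. if ij = (i', d - i') then c i' else 0) = (\<lambda>(i, j). if i + j = d then c i else 0)"
  proof (rule ext, clarify)
    fix i j :: nat
    have "(\<Sum>i'\<le>d. if i = i' \<and> j = d - i' then c i' else 0) = (\<Sum>i'\<le>d. if i = i' then if i + j = d then c i else 0 else 0)"
      by (rule sum.cong) auto
    then show "(\<Sum>i'\<le>d. if (i, j) = (i', d - i') then c i' else 0) = (if i + j = d then c i else 0)"
      by simp
  qed
  moreover have "finite_expansion (\<lambda>z w. \<Sum>i\<le>d. c i * z ^ i * w ^ (d - i)) (\<lambda>ij. \<Sum>i'\<le>d. if ij = (i', d - i') then c i' else 0)"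
    by (intro finite_expansion_sum finite_expansion_monomial) auto
  ultimately show ?thesis by simp
qed

lemma finite_expansion_polys2:
  assumes "g \<in> polys2"
  obtains b where "finite_expansion g b"
proof -
  obtain N c where g: "g = (\<lambda>z w. \<Sum>i\<le>N. \<Sum>j\<le>N. c i j * z ^ i * w ^ j)"
    using assms unfolding polys2_def by blast
  have "finite_expansion g (\<lambda>ij. \<Sum>i\<le>N. \<Sum>j\<le>N. if ij = (i, j) then c i j else 0)"
    unfolding g by (intro finite_expansion_sum finite_expansion_monomial) auto
  then show ?thesis by (rule that)
qed

lemma hardy_inner_finite_expansion:
  assumes "finite_expansion F a" "finite_expansion G b"
    and "finite S" "\<And>ij. ij \<notin> S \<Longrightarrow> a ij * cnj (b ij) = 0"
  shows "hardy_inner F G = (\<Sum>ij\<in>S. a ij * cnj (b ij))"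
proof -
  have "taylor_coeff F = a" "taylor_coeff G = b"
    using assms(1,2) unfolding finite_expansion_def by (auto intro: taylor_coeff_eq)
  then have "hardy_inner F G = (\<Sum>\<^sub>\<infinity>ij. a ij * cnj (b ij))"
    by (simp add: hardy_inner_def)
  also have "\<dots> = (\<Sum>ij\<in>S. a ij * cnj (b ij))"
    by (rule infsumI, rule has_sum_finite_neutralI[of S]) (use assms(3,4) in auto)
  finally show ?thesis .
qed

text \<open>Taylor coefficients are continuous in the Hardy norm; this is what lets coefficient
  identities survive the closure in \<open>submodule_gen\<close>.\<close>

lemma coeff_le_hardy_norm:
  assumes "finite_expansion F a"
  shows "norm (a ij) \<le> hardy_norm F"
proof -
  define S where "S = {ij. a ij \<noteq> 0}"
  have S: "finite S" using assms unfolding S_def finite_expansion_def by simp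
  have "hardy_inner F F = (\<Sum>ij\<in>S. a ij * cnj (a ij))"
    by (rule hardy_inner_finite_expansion[OF assms assms S]) (auto simp: S_def)
  also have "\<dots> = of_real (\<Sum>ij\<in>S. (norm (a ij))\<^sup>2)"
    by (simp only: complex_norm_square[symmetric] of_real_sum)
  finally have eq: "hardy_norm F = sqrt (\<Sum>ij\<in>S. (norm (a ij))\<^sup>2)"
    by (simp add: hardy_norm_def)
  show ?thesis
  proof (cases "ij \<in> S")
    case True
    then have "(norm (a ij))\<^sup>2 \<le> (\<Sum>ij\<in>S. (norm (a ij))\<^sup>2)"
      using S by (intro member_le_sum) auto
    then show ?thesis unfolding eq by (rule real_le_rsqrt)
  next
    case False
    then show ?thesis unfolding eq by (auto simp: S_def sum_nonneg)
  qed
qed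

text \<open>Forms of different degree have disjoint supports. This case split is what makes the
  double sum over \<open>j\<close> and \<open>n\<close> diagonal.\<close>

lemma hardy_inner_homogeneous:
  "hardy_inner (\<lambda>z w. \<Sum>i\<le>d. a i * z ^ i * w ^ (d - i)) (\<lambda>z w. \<Sum>i\<le>e. b i * z ^ i * w ^ (e - i)) =
     (if d = e then \<Sum>i\<le>d. a i * cnj (b i) else 0)"
proof -
  let ?S = "(\<lambda>i. (i, d - i)) ` {..d}"
  have notin: "i + j \<noteq> d" if "(i, j) \<notin> ?S" for i j
  proof
    assume "i + j = d"
    then have "(i, j) \<in> ?S" by (intro image_eqI[of _ _ i]) auto
    with that show False by simp
  qed
  have "hardy_inner (\<lambda>z w. \<Sum>i\<le>d. a i * z ^ i * w ^ (d - i)) (\<lambda>z w. \<Sum>i\<le>e. b i * z ^ i * w ^ (e - i)) =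
     (\<Sum>(i, j)\<in>?S. (if i + j = d then a i else 0) * cnj (if i + j = e then b i else 0))"
    by (subst hardy_inner_finite_expansion[OF finite_expansion_homogeneous finite_expansion_homogeneous, of ?S])
       (auto simp: case_prod_unfold dest: notin)
  also have "\<dots> = (\<Sum>i\<le>d. a i * cnj (if d = e then b i else 0))"
    by (subst sum.reindex) (auto simp: inj_on_def intro!: sum.cong)
  finally show ?thesis by simp
qed

subsection \<open>Orthonormal polynomials on the circle\<close>

text \<open>By Parseval this is the inner product of L^2 of the circle, see
  \<open>integral_circle_haar_poly\<close>. Cutting the sum at the degree of the first argument is
  harmless, since later terms vanish.\<close>

definition coeff_inner :: "complex poly \<Rightarrow> complex poly \<Rightarrow> complex" where
  "coeff_inner f g = (\<Sum>i\<le>degree f. coeff f i * cnj (coeff g i))"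

lemma coeff_inner_eq_sum:
  assumes "degree f \<le> N"
  shows "coeff_inner f g = (\<Sum>i\<le>N. coeff f i * cnj (coeff g i))"
  unfolding coeff_inner_def using assms
  by (intro sum.mono_neutral_left) (auto simp: coeff_eq_0)

lemma coeff_inner_commute: "coeff_inner g f = cnj (coeff_inner f g)"
proof -
  let ?N = "max (degree f) (degree g)"
  have "coeff_inner g f = (\<Sum>i\<le>?N. coeff g i * cnj (coeff f i))" by (rule coeff_inner_eq_sum) simp
  moreover have "coeff_inner f g = (\<Sum>i\<le>?N. coeff f i * cnj (coeff g i))" by (rule coeff_inner_eq_sum) simp
  ultimately show ?thesis by (simp add: mult.commute)
qed

lemma coeff_inner_add_left: "coeff_inner (f + g) h = coeff_inner f h + coeff_inner g h"
proof -
  let ?N = "max (degree f) (degree g)"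
  have "degree (f + g) \<le> ?N" by (rule degree_add_le) auto
  then show ?thesis
    by (simp add: coeff_inner_eq_sum[of _ ?N] algebra_simps sum.distrib)
qed

lemma coeff_inner_smult_left: "coeff_inner (smult c f) h = c * coeff_inner f h"
  by (subst coeff_inner_eq_sum[OF degree_smult_le]) (simp add: coeff_inner_def sum_distrib_left mult.assoc)

lemma coeff_inner_smult_right: "coeff_inner f (smult c h) = cnj c * coeff_inner f h"
  by (simp add: coeff_inner_def sum_distrib_left mult_ac)

lemma coeff_inner_diff_left: "coeff_inner (f - g) h = coeff_inner f h - coeff_inner g h"
  using coeff_inner_add_left[of f "- g" h] coeff_inner_smult_left[of "-1" g h] by simp

lemma coeff_inner_diff_right: "coeff_inner h (f - g) = coeff_inner h f - coeff_inner h g"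
  by (simp add: coeff_inner_def sum_subtractf algebra_simps)

lemma coeff_inner_self: "coeff_inner f f = of_real (\<Sum>i\<le>degree f. (norm (coeff f i))\<^sup>2)"
  by (simp only: coeff_inner_def complex_norm_square[symmetric] of_real_sum)

lemma coeff_inner_self_eq_0: "coeff_inner f f = 0 \<longleftrightarrow> f = 0"
proof
  assume "coeff_inner f f = 0"
  then have "(\<Sum>i\<le>degree f. (norm (coeff f i))\<^sup>2) = 0"
    unfolding coeff_inner_self by (simp only: of_real_eq_0_iff)
  then have "(norm (coeff f (degree f)))\<^sup>2 = 0"
    by (subst (asm) sum_nonneg_eq_0_iff) auto
  then show "f = 0" by simp
qed (simp add: coeff_inner_def)

section \<open>Moments of Haar measure and of the weighted measure\<close>

lemma integral_cis_power:
  "(LINT x|lborel. indicator {0..2 * pi} x *\<^sub>R (cis x ^ i * cnj (cis x) ^ j)) = (if i = j then of_real (2 * pi) else 0)"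
proof (cases "i = j")
  case True
  have "cis x ^ i * cnj (cis x) ^ i = 1" for x
    by (simp add: power_mult_distrib[symmetric] cis_mult cis_cnj)
  then show ?thesis using True by (simp add: scaleR_conv_of_real)
next
  case False
  define k where "k = real i - real j"
  have k: "k \<noteq> 0" using False by (simp add: k_def)
  have eq: "cis x ^ i * cnj (cis x) ^ j = cis (k * x)" for x
    by (simp add: cis_cnj Complex.DeMoivre cis_mult k_def algebra_simps)
  have "(LINT x|lborel. indicator {0..2 * pi} x *\<^sub>R cis (k * x)) =
        - \<i> / of_real k * cis (k * (2 * pi)) - (- \<i> / of_real k * cis (k * 0))"
  proof (rule integral_FTC_atLeastAtMost)
    show "continuous_on {0..2 * pi} (\<lambda>x. cis (k * x))" by (intro continuous_intros)
    fix x :: real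
    have "((\<lambda>x. exp (\<i> * of_real k * of_real x)) has_vector_derivative
            exp (\<i> * of_real k * of_real x) * (\<i> * of_real k)) (at x within {0..2 * pi})"
      by (rule has_vector_derivative_real_field) (auto intro!: derivative_eq_intros)
    then have "((\<lambda>x. cis (k * x)) has_vector_derivative (of_real k * (\<i> * cis (k * x)))) (at x within {0..2 * pi})"
      by (simp add: cis_conv_exp mult_ac)
    then have "((\<lambda>x. - \<i> / of_real k * cis (k * x)) has_vector_derivative (- \<i> / of_real k * (of_real k * (\<i> * cis (k * x))))) (at x within {0..2 * pi})"
      by (rule has_vector_derivative_mult_right)
    then show "((\<lambda>x. - \<i> / of_real k * cis (k * x)) has_vector_derivative cis (k * x)) (at x within {0..2 * pi})"
      using k by (simp add: field_simps)
  qed simp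
  also have "cis (k * (2 * pi)) = 1"
  proof -
    have "cis (k * (2 * pi)) = cis (2 * pi * (of_int (int i - int j)))" by (simp add: k_def mult.commute)
    also have "\<dots> = 1" by (rule cis_multiple_2pi) simp
    finally show ?thesis .
  qed
  finally show ?thesis using False by (simp add: eq)
qed

lemma measurable_cis [measurable]: "cis \<in> borel_measurable borel"
  by (intro borel_measurable_continuous_onI continuous_intros)

lemma prob_space_circle_haar: "prob_space circle_haar"
  unfolding circle_haar_def
  by (intro prob_space.prob_space_distr prob_space_uniform_measure) auto

lemma AE_circle_haar_norm: "AE \<zeta> in circle_haar. norm \<zeta> = 1"
  unfolding circle_haar_def by (subst AE_distr_iff) auto

lemma sets_circle_haar [measurable_cong, simp]: "sets circle_haar = sets borel"
  by (simp add: circle_haar_def)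

lemma integrable_circle_haar_power: "integrable circle_haar (\<lambda>\<zeta>. \<zeta> ^ i * cnj \<zeta> ^ j)"
proof -
  interpret prob_space circle_haar by (rule prob_space_circle_haar)
  show ?thesis
  proof (rule integrable_const_bound[where B = 1])
    show "AE \<zeta> in circle_haar. norm (\<zeta> ^ i * cnj \<zeta> ^ j) \<le> 1"
      using AE_circle_haar_norm by eventually_elim (simp add: norm_mult norm_power)
    show "(\<lambda>\<zeta>. \<zeta> ^ i * cnj \<zeta> ^ j) \<in> borel_measurable circle_haar"
      by (simp add: borel_measurable_continuous_onI continuous_intros cong: measurable_cong_sets)
  qed
qed

lemma integral_circle_haar_power: "(\<integral>\<zeta>. \<zeta> ^ i * cnj \<zeta> ^ j \<partial>circle_haar) = (if i = j then 1 else 0)"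
proof -
  have dens: "uniform_measure lborel {0..2 * pi} = density lborel (\<lambda>x. ennreal (indicator {0..2 * pi} x / (2 * pi)))"
  proof -
    have "(indicator {0..2 * pi} x :: ennreal) / ennreal (2 * pi) = ennreal (indicator {0..2 * pi} x / (2 * pi))" for x
      using divide_ennreal[of "indicator {0..2 * pi} x" "2 * pi"] by (simp add: ennreal_indicator)
    then show ?thesis unfolding uniform_measure_def by simp
  qed
  have [measurable]: "(\<lambda>x::real. cis x ^ i * cnj (cis x) ^ j) \<in> borel_measurable borel"
    by (intro borel_measurable_continuous_onI continuous_intros)
  have [measurable]: "(\<lambda>\<zeta>. \<zeta> ^ i * cnj \<zeta> ^ j) \<in> borel_measurable borel"
    by (intro borel_measurable_continuous_onI continuous_intros)
  have "(\<integral>\<zeta>. \<zeta> ^ i * cnj \<zeta> ^ j \<partial>circle_haar) = (\<integral>x. cis x ^ i * cnj (cis x) ^ j \<partial>uniform_measure lborel {0..2 * pi})"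
    unfolding circle_haar_def by (subst integral_distr) auto
  also have "\<dots> = (LINT x|lborel. (indicator {0..2 * pi} x / (2 * pi)) *\<^sub>R (cis x ^ i * cnj (cis x) ^ j))"
    unfolding dens by (subst integral_density) auto
  also have "\<dots> = (LINT x|lborel. (1 / (2 * pi)) *\<^sub>R (indicator {0..2 * pi} x *\<^sub>R (cis x ^ i * cnj (cis x) ^ j)))"
    by (simp add: mult.commute)
  also have "\<dots> = (1 / (2 * pi)) *\<^sub>R (LINT x|lborel. indicator {0..2 * pi} x *\<^sub>R (cis x ^ i * cnj (cis x) ^ j))"
    by (rule integral_scaleR_right)
  finally show ?thesis unfolding integral_cis_power by (simp add: scaleR_conv_of_real)
qed

lemma poly_mult_cnj_poly:
  "poly f \<zeta> * cnj (poly g \<zeta>) = (\<Sum>i\<le>degree f. \<Sum>j\<le>degree g. (coeff f i * cnj (coeff g j)) * (\<zeta> ^ i * cnj \<zeta> ^ j))"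
  by (simp add: poly_altdef sum_product mult_ac)

lemma integral_circle_haar_poly: "(\<integral>\<zeta>. poly f \<zeta> * cnj (poly g \<zeta>) \<partial>circle_haar) = coeff_inner f g"
proof -
  have "(\<integral>\<zeta>. poly f \<zeta> * cnj (poly g \<zeta>) \<partial>circle_haar) =
        (\<Sum>i\<le>degree f. \<Sum>j\<le>degree g. (coeff f i * cnj (coeff g j)) * (if i = j then 1 else 0))"
    unfolding poly_mult_cnj_poly
    by (simp add: Bochner_Integration.integral_sum integrable_circle_haar_power integral_circle_haar_power
        cong: if_cong)
  also have "\<dots> = (\<Sum>i\<le>degree f. coeff f i * cnj (coeff g i))"
    by (rule sum.cong) (auto simp: if_distrib[of "(*) _"] sum.delta coeff_eq_0 cong: if_cong)
  finally show ?thesis by (simp add: coeff_inner_def)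
qed

text \<open>The density is absorbed into the polynomials: \<open>f\<close> times the conjugate of
  \<open>g\<close> times |q|^2 is the product of \<open>q * f\<close> with the conjugate of
  \<open>q * g\<close>. Orthogonality for the weighted measure becomes plain coefficient
  orthogonality among the multiples of \<open>q\<close>.\<close>

lemma integral_circle_measure:
  assumes p: "\<And>\<zeta>. p \<zeta> 1 = poly q \<zeta>"
  shows "(\<integral>\<zeta>. poly f \<zeta> * cnj (poly g \<zeta>) \<partial>circle_measure p) =
         coeff_inner (q * f) (q * g) / coeff_inner q q"
proof -
  define Z where "Z = (\<Sum>i\<le>degree q. (norm (coeff q i))\<^sup>2)"
  have [measurable]: "(\<lambda>\<zeta>. poly f \<zeta>) \<in> borel_measurable borel" for f :: "complex poly"
    by (intro borel_measurable_continuous_onI continuous_intros)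
  have [measurable]: "cnj \<in> borel_measurable borel"
    by (intro borel_measurable_continuous_onI continuous_intros)
  have "complex_of_real (\<integral>\<zeta>. (norm (p \<zeta> 1))\<^sup>2 \<partial>circle_haar) = (\<integral>\<zeta>. of_real ((norm (p \<zeta> 1))\<^sup>2) \<partial>circle_haar)"
    by (rule integral_complex_of_real[symmetric])
  also have "\<dots> = coeff_inner q q"
    by (simp only: complex_norm_square p integral_circle_haar_poly)
  finally have Z: "(\<integral>\<zeta>. (norm (p \<zeta> 1))\<^sup>2 \<partial>circle_haar) = Z"
    unfolding coeff_inner_self Z_def of_real_eq_iff .
  have "(\<integral>\<zeta>. poly f \<zeta> * cnj (poly g \<zeta>) \<partial>circle_measure p) =
        (\<integral>\<zeta>. ((norm (p \<zeta> 1))\<^sup>2 / Z) *\<^sub>R (poly f \<zeta> * cnj (poly g \<zeta>)) \<partial>circle_haar)"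
    unfolding circle_measure_def Z by (subst integral_density) (auto simp: p Z_def intro!: sum_nonneg divide_nonneg_nonneg)
  also have "(\<lambda>\<zeta>. ((norm (p \<zeta> 1))\<^sup>2 / Z) *\<^sub>R (poly f \<zeta> * cnj (poly g \<zeta>))) =
        (\<lambda>\<zeta>. (poly (q * f) \<zeta> * cnj (poly (q * g) \<zeta>)) / of_real Z)"
  proof
    fix \<zeta>
    have "complex_of_real ((norm (p \<zeta> 1))\<^sup>2) = poly q \<zeta> * cnj (poly q \<zeta>)"
      by (simp only: complex_norm_square p)
    then show "((norm (p \<zeta> 1))\<^sup>2 / Z) *\<^sub>R (poly f \<zeta> * cnj (poly g \<zeta>)) =
        (poly (q * f) \<zeta> * cnj (poly (q * g) \<zeta>)) / of_real Z"
      unfolding scaleR_conv_of_real of_real_divide by simp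
  qed
  also have "(\<integral>\<zeta>. (poly (q * f) \<zeta> * cnj (poly (q * g) \<zeta>)) / of_real Z \<partial>circle_haar) =
      coeff_inner (q * f) (q * g) / of_real Z"
    by (subst integral_divide_zero) (simp only: integral_circle_haar_poly)
  finally show ?thesis by (simp add: coeff_inner_self Z_def)
qed

text \<open>The \<open>n\<close>-th member of an orthonormal system is orthogonal to everything of
  lower degree. Scaling two candidates to a common leading coefficient, their difference has lower
  degree, so it is orthogonal to both candidates and hence to itself. Comparing norms identifies the
  two positive leading coefficients.\<close>

lemma orthonormal_polys_unique:
  assumes int: "\<And>f g. (\<integral>\<zeta>. poly f \<zeta> * cnj (poly g \<zeta>) \<partial>\<mu>) = coeff_inner (q * f) (q * g) / c"
    and c: "c \<noteq> 0" and q: "q \<noteq> 0"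
    and \<phi>: "orthonormal_polys \<mu> \<phi>" and \<psi>: "orthonormal_polys \<mu> \<psi>"
  shows "\<phi> = \<psi>"
proof
  fix n
  define B where "B = (\<lambda>f g. coeff_inner (q * f) (q * g) / c)"
  have B_diff_left: "B (f - g) h = B f h - B g h" for f g h
    by (simp add: B_def right_diff_distrib coeff_inner_diff_left diff_divide_distrib)
  have B_diff_right: "B h (f - g) = B h f - B h g" for f g h
    by (simp add: B_def right_diff_distrib coeff_inner_diff_right diff_divide_distrib)
  have B_smult_left: "B (smult a f) h = a * B f h" for a f h
    by (simp add: B_def coeff_inner_smult_left)
  have B_smult_right: "B h (smult a f) = cnj a * B h f" for a f h
    by (simp add: B_def coeff_inner_smult_right)
  have B_self: "B f f = 0 \<longleftrightarrow> f = 0" for f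
    using c q by (simp add: B_def coeff_inner_self_eq_0)
  have orth: "B g (\<eta> n) = 0" if \<eta>: "orthonormal_polys \<mu> \<eta>" and "g = 0 \<or> degree g < n" for \<eta> g
    using that(2)
  \<comment> \<open>The measure puts the zero polynomial strictly below the nonzero constants, which
    \<open>degree\<close> alone does not.\<close>
  proof (induction "if g = 0 then 0 else Suc (degree g)" arbitrary: g rule: less_induct)
    case less
    show ?case
    proof (cases "g = 0")
      case True
      then show ?thesis by (simp add: B_def coeff_inner_def)
    next
      case False
      define m where "m = degree g"
      have m: "m < n" using less.prems False by (simp add: m_def)
      obtain k where k: "k > 0" "lead_coeff (\<eta> m) = complex_of_real k" "degree (\<eta> m) = m"
        using \<eta> unfolding orthonormal_polys_def by blast
      define a where "a = lead_coeff g / complex_of_real k"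
      define h where "h = g - smult a (\<eta> m)"
      have "coeff h i = 0" if "i \<ge> m" for i
      proof (cases "i = m")
        case True
        then show ?thesis using k by (simp add: h_def a_def m_def)
      next
        case False
        then show ?thesis using k that by (simp add: h_def coeff_eq_0 m_def)
      qed
      then have h: "h = 0 \<or> degree h < m"
        by (metis leading_coeff_0_iff not_le)
      have "B h (\<eta> n) = 0"
        by (rule less.hyps) (use h m False in \<open>auto simp: m_def\<close>)
      moreover have "B (\<eta> m) (\<eta> n) = 0"
        using \<eta> m unfolding orthonormal_polys_def int B_def by simp
      ultimately show ?thesis
        by (simp add: h_def B_diff_left B_smult_left)
    qed
  qed
  obtain k where k: "k > 0" "lead_coeff (\<phi> n) = complex_of_real k" "degree (\<phi> n) = n"
    using \<phi> unfolding orthonormal_polys_def by blast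
  obtain l where l: "l > 0" "lead_coeff (\<psi> n) = complex_of_real l" "degree (\<psi> n) = n"
    using \<psi> unfolding orthonormal_polys_def by blast
  define r where "r = smult (of_real l) (\<phi> n) - smult (of_real k) (\<psi> n)"
  have "coeff r i = 0" if "i \<ge> n" for i
  proof (cases "i = n")
    case True
    then show ?thesis using k l by (simp add: r_def)
  next
    case False
    then show ?thesis using k l that by (simp add: r_def coeff_eq_0)
  qed
  then have "r = 0 \<or> degree r < n"
    by (metis leading_coeff_0_iff not_le)
  then have "B r (\<phi> n) = 0" "B r (\<psi> n) = 0" using orth \<phi> \<psi> by auto
  then have "B r r = 0"
    by (subst (2) r_def) (simp add: B_diff_right B_smult_right)
  then have eq: "smult (of_real l) (\<phi> n) = smult (of_real k) (\<psi> n)"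
    by (simp add: B_self r_def)
  have "B (smult (of_real l) (\<phi> n)) (smult (of_real l) (\<phi> n)) = of_real (l * l)"
    using \<phi> unfolding B_smult_left B_smult_right unfolding B_def int[symmetric] orthonormal_polys_def by simp
  moreover have "B (smult (of_real k) (\<psi> n)) (smult (of_real k) (\<psi> n)) = of_real (k * k)"
    using \<psi> unfolding B_smult_left B_smult_right unfolding B_def int[symmetric] orthonormal_polys_def by simp
  ultimately have "l * l = k * k" unfolding eq by (metis of_real_eq_iff)
  then have "l = k" using k(1) l(1) by (simp add: power2_eq_square[symmetric])
  with eq l(1) show "\<phi> n = \<psi> n" by (metis of_real_eq_0_iff less_irrefl smult_cancel)
qed

lemma onp_circle_measure_eq:
  assumes p: "\<And>\<zeta>. p \<zeta> 1 = poly q \<zeta>" and q: "q \<noteq> 0"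
    and \<phi>: "orthonormal_polys (circle_measure p) \<phi>"
  shows "onp (circle_measure p) = \<phi>"
  unfolding onp_def
proof (rule the_equality)
  fix \<psi> assume \<psi>: "orthonormal_polys (circle_measure p) \<psi>"
  show "\<psi> = \<phi>"
    by (rule orthonormal_polys_unique[OF integral_circle_measure[of p q, OF p] _ q \<psi> \<phi>])
       (use q in \<open>simp add: coeff_inner_self_eq_0\<close>)
qed (rule \<phi>)

subsection \<open>Two conjugate zeros on the circle\<close>

lemma sum_cos_arith_progression:
  fixes x t :: real
  shows "(\<Sum>i<n. cos (x + 2 * real i * t)) * sin t = cos (x + (real n - 1) * t) * sin (real n * t)"
proof (induction n)
  case (Suc n)
  have "cos (x + (real n - 1) * t) * sin (real n * t) + cos (x + 2 * real n * t) * sin t =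
        cos (x + (real (Suc n) - 1) * t) * sin (real (Suc n) * t)"
    unfolding cos_times_sin by (simp add: algebra_simps add_divide_distrib diff_divide_distrib)
  with Suc show ?case by (simp add: distrib_right)
qed simp

text \<open>At \<open>m = 1\<close> there is equality. Strictness enters at \<open>m = 2\<close>
  through |cos t| < 1, and the induction merely carries it along. It keeps the Gram determinant in
  \<open>kernel_scale\<close> positive.\<close>

lemma abs_sin_mult_less:
  fixes t :: real
  assumes "sin t \<noteq> 0" "m \<ge> 2"
  shows "\<bar>sin (real m * t)\<bar> < real m * \<bar>sin t\<bar>"
  using assms(2)
proof (induction m rule: dec_induct)
  case base
  have "(cos t)\<^sup>2 < 1" using assms(1) by (simp add: cos_squared_eq)
  then have "\<bar>cos t\<bar> < 1" by (simp add: abs_square_less_1)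
  then have "\<bar>sin t\<bar> * \<bar>cos t\<bar> < \<bar>sin t\<bar> * 1" using assms(1) by (intro mult_strict_left_mono) auto
  then show ?case by (simp add: sin_double abs_mult)
next
  case (step m)
  have "\<bar>sin (real (Suc m) * t)\<bar> = \<bar>sin (real m * t) * cos t + cos (real m * t) * sin t\<bar>"
    by (simp add: algebra_simps sin_add)
  also have "\<dots> \<le> \<bar>sin (real m * t)\<bar> * \<bar>cos t\<bar> + \<bar>cos (real m * t)\<bar> * \<bar>sin t\<bar>"
    by (metis abs_mult abs_triangle_ineq)
  also have "\<dots> \<le> \<bar>sin (real m * t)\<bar> * 1 + 1 * \<bar>sin t\<bar>"
    by (intro add_mono mult_left_mono mult_right_mono) auto
  also have "\<dots> < real m * \<bar>sin t\<bar> + \<bar>sin t\<bar>" using step by simp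
  finally show ?case by (simp add: algebra_simps)
qed

text \<open>The hypothesis says that the zeros \<open>cis t\<close> and \<open>cis (- t)\<close> are
  distinct. The angle stays general until explicit values are needed.\<close>

locale arc_weight =
  fixes t :: real
  assumes sin_t: "sin t \<noteq> 0"
begin

text \<open>The Chebyshev value U_(m-1)(cos t). Up to a unimodular factor it is the inner product of
  the two Szego kernels of degree below \<open>m\<close>, each of which has squared norm
  \<open>m\<close>.\<close>

definition sin_quot :: "nat \<Rightarrow> real" where
  "sin_quot m = sin (real m * t) / sin t"

text \<open>The denominator is the Gram determinant of the two kernels; the 2 compensates the halves
  from the product-to-sum formulas.\<close>

definition kernel_scale :: "nat \<Rightarrow> real" where
  "kernel_scale m = 2 / ((real m)\<^sup>2 - (sin_quot m)\<^sup>2)"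

text \<open>The coefficients of \<open>q\<close> times the monic orthogonal polynomial of degree \<open>m - 2\<close>, apart from the leading
  one: \<open>\<zeta>\<^sup>m + \<Sum> low_coeff m i \<zeta>\<^sup>i\<close> is the only such sum, with \<open>low_coeff m i\<close> a combination of
  \<open>cos (i t)\<close> and \<open>sin (i t)\<close>, that vanishes at \<open>cis t\<close> and \<open>cis (- t)\<close>.\<close>

definition low_coeff :: "nat \<Rightarrow> nat \<Rightarrow> real" where
  "low_coeff m i = - kernel_scale m *
     (real m * cos (real i * t - real m * t) - sin_quot m * cos (real i * t + t))"

lemma sum_cos_eq: "(\<Sum>i<n. cos (x + 2 * real i * t)) = sin_quot n * cos (x + (real n - 1) * t)"
  using sum_cos_arith_progression[where n = n and x = x and t = t] sin_t by (simp add: sin_quot_def field_simps)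

lemma sin_quot_square_less:
  assumes "m \<ge> 2"
  shows "(sin_quot m)\<^sup>2 < (real m)\<^sup>2"
proof -
  have "\<bar>sin_quot m\<bar> < real m"
    using abs_sin_mult_less[OF sin_t assms] sin_t by (simp add: sin_quot_def abs_divide field_simps)
  then show ?thesis using power_strict_mono[of "\<bar>sin_quot m\<bar>" "real m" 2] by simp
qed

text \<open>After the product-to-sum formulas, the weights \<open>m\<close> and
  \<open>- sin_quot m\<close> in \<open>low_coeff\<close> cancel the unwanted
  \<open>cos (y - t)\<close> and leave the Gram determinant. The free phase \<open>y\<close> pays
  off: 0 and -pi/2 give real and imaginary parts of the value at a zero, while \<open>- m t\<close>
  and \<open>t\<close> give the norm.\<close>

lemma sum_low_coeff_cos:
  assumes "m \<ge> 2"
  shows "(\<Sum>i<m. low_coeff m i * cos (real i * t + y)) = - cos (real m * t + y)"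
proof -
  let ?s = "sin_quot m"
  have E: "(real m)\<^sup>2 - ?s\<^sup>2 \<noteq> 0" using sin_quot_square_less[OF assms] by simp
  have 1: "(\<Sum>i<m. cos (real i * t - real m * t) * cos (real i * t + y)) =
        (real m * cos (real m * t + y) + ?s * cos (y - t)) / 2"
  proof -
    have "cos (real i * t - real m * t) * cos (real i * t + y) =
        (cos (real m * t + y) + cos ((y - real m * t) + 2 * real i * t)) / 2" for i
      by (subst cos_times_cos, subst cos_minus[symmetric], simp add: algebra_simps)
    then have "(\<Sum>i<m. cos (real i * t - real m * t) * cos (real i * t + y)) =
        (\<Sum>i<m. cos (real m * t + y) + cos ((y - real m * t) + 2 * real i * t)) / 2"
      by (simp only: sum_divide_distrib)
    also have "\<dots> = (real m * cos (real m * t + y) + ?s * cos ((y - real m * t) + (real m - 1) * t)) / 2"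
      by (simp only: sum.distrib sum_cos_eq) simp
    finally show ?thesis by (simp add: algebra_simps)
  qed
  have 2: "(\<Sum>i<m. cos (real i * t + t) * cos (real i * t + y)) =
        (real m * cos (y - t) + ?s * cos (real m * t + y)) / 2"
  proof -
    have "cos (real i * t + t) * cos (real i * t + y) =
        (cos (y - t) + cos ((y + t) + 2 * real i * t)) / 2" for i
      by (subst cos_times_cos, subst cos_minus[symmetric], simp add: algebra_simps)
    then have "(\<Sum>i<m. cos (real i * t + t) * cos (real i * t + y)) =
        (\<Sum>i<m. cos (y - t) + cos ((y + t) + 2 * real i * t)) / 2"
      by (simp only: sum_divide_distrib)
    also have "\<dots> = (real m * cos (y - t) + ?s * cos ((y + t) + (real m - 1) * t)) / 2"
      by (simp only: sum.distrib sum_cos_eq) simp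
    finally show ?thesis by (simp add: algebra_simps)
  qed
  have "(\<Sum>i<m. low_coeff m i * cos (real i * t + y)) =
     - kernel_scale m * (real m * (\<Sum>i<m. cos (real i * t - real m * t) * cos (real i * t + y))
        - ?s * (\<Sum>i<m. cos (real i * t + t) * cos (real i * t + y)))"
    by (simp add: low_coeff_def sum_distrib_left sum_subtractf sum_negf algebra_simps)
  also have "\<dots> = - (kernel_scale m * (((real m)\<^sup>2 - ?s\<^sup>2) / 2)) * cos (real m * t + y)"
    unfolding 1 2 by (simp add: field_simps power2_eq_square)
  also have "kernel_scale m * (((real m)\<^sup>2 - ?s\<^sup>2) / 2) = 1"
    using E by (simp add: kernel_scale_def)
  finally show ?thesis by simp
qed

text \<open>Only one of the two factors is expanded; what remains are two instances of
  \<open>sum_low_coeff_cos\<close>.\<close>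

lemma sum_low_coeff_square:
  assumes "m \<ge> 2"
  shows "(\<Sum>i<m. (low_coeff m i)\<^sup>2) = kernel_scale m * (real m - sin_quot m * cos (real m * t + t))"
proof -
  have "(\<Sum>i<m. (low_coeff m i)\<^sup>2) = - kernel_scale m *
     (real m * (\<Sum>i<m. low_coeff m i * cos (real i * t + (- real m * t))) - sin_quot m * (\<Sum>i<m. low_coeff m i * cos (real i * t + t)))"
    unfolding power2_eq_square
    by (subst (2) low_coeff_def) (simp add: sum_distrib_left sum_subtractf sum_negf algebra_simps)
  then show ?thesis
    unfolding sum_low_coeff_cos[OF assms] by (simp add: algebra_simps)
qed

text \<open>Each product of cosines splits into a cosine independent of \<open>i\<close>, which
  contributes the number \<open>m - k + 1\<close> of terms, and one running through an arithmetic
  progression, which contributes \<open>sin_quot (m - k + 1)\<close>. The three groups come from the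
  two kinds of cosine in \<open>low_coeff\<close>; the two mixed products agree by reversing the
  sum.\<close>

lemma sum_low_coeff_convolution:
  assumes "m \<ge> k"
  shows "(\<Sum>i\<le>m - k. low_coeff m i * low_coeff m (m - k - i)) =
    (kernel_scale m)\<^sup>2 / 2 *
     ((real m)\<^sup>2 * ((real m - real k + 1) * cos ((real m + real k) * t) + sin_quot (m - k + 1))
      - 2 * real m * sin_quot m * ((real m - real k + 1) * cos ((real k - 1) * t)
          + cos ((real m + 1) * t) * sin_quot (m - k + 1))
      + (sin_quot m)\<^sup>2 * ((real m - real k + 1) * cos ((real m - real k + 2) * t) + sin_quot (m - k + 1)))"
proof -
  define d where "d = m - k"
  have d: "real d = real m - real k" using assms by (simp add: d_def of_nat_diff)
  define c1 where "c1 = (\<lambda>i. cos (real i * t - real m * t))"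
  define c2 where "c2 = (\<lambda>i. cos (real i * t + t))"
  define S where "S = sin_quot (m - k + 1)"
  have sumS: "(\<Sum>i\<le>d. cos (x + 2 * real i * t)) = S * cos (x + real d * t)" for x
    using sum_cos_eq[of x "Suc d"] by (simp add: S_def d_def lessThan_Suc_atMost)
  have prod: "(real d + 1) * A + S * B = 2 * (\<Sum>i\<le>d. F i)"
    if "\<And>i. i \<le> d \<Longrightarrow> F i = (A + cos (x + 2 * real i * t)) / 2" "cos (x + real d * t) = B" for A B x F
  proof -
    have "2 * (\<Sum>i\<le>d. F i) = (\<Sum>i\<le>d. A + cos (x + 2 * real i * t))"
      unfolding sum_distrib_left by (intro sum.cong) (auto simp: that(1))
    also have "\<dots> = (\<Sum>i\<le>d. A) + S * cos (x + real d * t)" by (simp only: sum.distrib sumS)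
    finally show ?thesis using that(2) by simp
  qed
  have 1: "(real d + 1) * cos ((real m + real k) * t) + S * 1 = 2 * (\<Sum>i\<le>d. c1 i * c1 (d - i))"
  proof (rule prod)
    fix i assume "i \<le> d"
    \<comment> \<open>Flipping the sign of this angle makes the difference of the two angles, rather
      than a combination that still contains \<open>i\<close>, the constant one.\<close>
    then have "c1 (d - i) = cos (- ((real d - real i) * t - real m * t))"
      unfolding cos_minus by (simp add: c1_def of_nat_diff)
    then have "c1 (d - i) = cos (real m * t - (real d - real i) * t)"
      by (simp only: minus_diff_eq)
    then have "c1 i * c1 (d - i) = (cos ((real i * t - real m * t) - (real m * t - (real d - real i) * t)) +
       cos ((real i * t - real m * t) + (real m * t - (real d - real i) * t))) / 2"
      by (simp add: c1_def cos_times_cos)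
    also have "(real i * t - real m * t) - (real m * t - (real d - real i) * t) = - ((real m + real k) * t)"
      by (simp add: d algebra_simps)
    also have "(real i * t - real m * t) + (real m * t - (real d - real i) * t) = - real d * t + 2 * real i * t"
      by (simp add: algebra_simps)
    finally show "c1 i * c1 (d - i) = (cos ((real m + real k) * t) + cos (- real d * t + 2 * real i * t)) / 2"
      by (simp only: cos_minus)
  qed simp
  have 2: "(real d + 1) * cos ((real m - real k + 2) * t) + S * 1 = 2 * (\<Sum>i\<le>d. c2 i * c2 (d - i))"
  proof (rule prod)
    fix i assume "i \<le> d"
    then have "c2 (d - i) = cos ((real d - real i) * t + t)"
      by (simp add: c2_def of_nat_diff)
    then have "c2 i * c2 (d - i) = (cos (((real d - real i) * t + t) + (real i * t + t)) +
       cos ((real i * t + t) - ((real d - real i) * t + t))) / 2"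
      by (simp add: c2_def cos_times_cos add_ac)
    also have "((real d - real i) * t + t) + (real i * t + t) = (real m - real k + 2) * t"
      by (simp add: d algebra_simps)
    also have "(real i * t + t) - ((real d - real i) * t + t) = - real d * t + 2 * real i * t"
      by (simp add: algebra_simps)
    finally show "c2 i * c2 (d - i) = (cos ((real m - real k + 2) * t) + cos (- real d * t + 2 * real i * t)) / 2" .
  qed simp
  have 3: "(real d + 1) * cos ((real k - 1) * t) + S * cos ((real m + 1) * t) = 2 * (\<Sum>i\<le>d. c2 i * c1 (d - i))"
  proof (rule prod)
    fix i assume "i \<le> d"
    then have "c1 (d - i) = cos (- ((real d - real i) * t - real m * t))"
      unfolding cos_minus by (simp add: c1_def of_nat_diff)
    then have "c1 (d - i) = cos (real m * t - (real d - real i) * t)"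
      by (simp only: minus_diff_eq)
    then have "c2 i * c1 (d - i) = cos (real m * t - (real d - real i) * t) * cos (real i * t + t)"
      by (simp add: c2_def mult.commute)
    also have "\<dots> = (cos ((real m * t - (real d - real i) * t) - (real i * t + t)) +
       cos ((real i * t + t) + (real m * t - (real d - real i) * t))) / 2"
      by (simp only: cos_times_cos add.commute)
    also have "(real m * t - (real d - real i) * t) - (real i * t + t) = (real k - 1) * t"
      by (simp add: d algebra_simps)
    also have "(real i * t + t) + (real m * t - (real d - real i) * t) = (real k + 1) * t + 2 * real i * t"
      by (simp add: d algebra_simps)
    finally show "c2 i * c1 (d - i) = (cos ((real k - 1) * t) + cos ((real k + 1) * t + 2 * real i * t)) / 2" .
  next
    show "cos ((real k + 1) * t + real d * t) = cos ((real m + 1) * t)" by (simp add: d algebra_simps)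
  qed
  have rev: "(\<Sum>i\<le>d. c1 i * c2 (d - i)) = (\<Sum>i\<le>d. c2 i * c1 (d - i))"
    by (rule sum.reindex_bij_witness[of _ "\<lambda>i. d - i" "\<lambda>i. d - i"]) (auto simp: mult.commute)
  have termwise: "low_coeff m i * low_coeff m (d - i) = (kernel_scale m)\<^sup>2 *
     ((real m)\<^sup>2 * (c1 i * c1 (d - i)) - real m * sin_quot m * (c1 i * c2 (d - i) + c2 i * c1 (d - i))
       + (sin_quot m)\<^sup>2 * (c2 i * c2 (d - i)))" for i
    unfolding low_coeff_def c1_def c2_def by algebra
  have "(\<Sum>i\<le>d. low_coeff m i * low_coeff m (d - i)) = (kernel_scale m)\<^sup>2 *
     ((real m)\<^sup>2 * (\<Sum>i\<le>d. c1 i * c1 (d - i)) - real m * sin_quot m * ((\<Sum>i\<le>d. c1 i * c2 (d - i)) + (\<Sum>i\<le>d. c2 i * c1 (d - i)))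
       + (sin_quot m)\<^sup>2 * (\<Sum>i\<le>d. c2 i * c2 (d - i)))"
    by (simp only: termwise sum_distrib_left[symmetric] sum.distrib sum_subtractf)
  also have "\<dots> = (kernel_scale m)\<^sup>2 / 2 *
     ((real m)\<^sup>2 * (2 * (\<Sum>i\<le>d. c1 i * c1 (d - i))) - 2 * real m * sin_quot m * (2 * (\<Sum>i\<le>d. c2 i * c1 (d - i)))
       + (sin_quot m)\<^sup>2 * (2 * (\<Sum>i\<le>d. c2 i * c2 (d - i))))"
    unfolding rev by (simp add: algebra_simps)
  finally show ?thesis
    unfolding 1[symmetric] 2[symmetric] 3[symmetric] S_def d_def[symmetric] d by (simp only: mult_1_right mult_1_left mult.commute)
qed


section \<open>Orthonormal polynomials of the arc weight\<close>

definition arc_poly :: "complex poly" where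
  "arc_poly = [:1, - of_real (2 * cos t), 1:]"

lemma arc_poly_eq: "arc_poly = [:- cis t, 1:] * [:- cis (- t), 1:]"
proof -
  have "cis t + cis (- t) = of_real (2 * cos t)" by (simp add: complex_eq_iff)
  moreover have "cis t * cis (- t) = 1" by (simp add: cis_mult)
  ultimately show ?thesis by (simp add: arc_poly_def algebra_simps)
qed

lemma degree_arc_poly: "degree arc_poly = 2"
  by (simp add: arc_poly_def)

lemma arc_poly_neq_0: "arc_poly \<noteq> 0"
  using degree_arc_poly by auto

lemma cis_t_neq: "cis t \<noteq> cis (- t)"
  using sin_t by (simp add: complex_eq_iff)

lemma arc_poly_dvd_iff: "arc_poly dvd f \<longleftrightarrow> poly f (cis t) = 0 \<and> poly f (cis (- t)) = 0"
proof
  assume "poly f (cis t) = 0 \<and> poly f (cis (- t)) = 0"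
  then have roots: "poly f (cis t) = 0" "poly f (cis (- t)) = 0" by auto
  then obtain g where g: "f = [:- cis t, 1:] * g" using poly_eq_0_iff_dvd dvd_def by metis
  have "poly g (cis (- t)) = 0" using roots(2) cis_t_neq by (simp add: g)
  then obtain h where "g = [:- cis (- t), 1:] * h" using poly_eq_0_iff_dvd dvd_def by metis
  then have "f = arc_poly * h" by (simp only: g arc_poly_eq mult.assoc)
  then show "arc_poly dvd f" by simp
next
  assume "arc_poly dvd f"
  then show "poly f (cis t) = 0 \<and> poly f (cis (- t)) = 0"
    by (elim dvdE) (simp only: arc_poly_eq poly_mult, simp)
qed

text \<open>This is \<open>q\<close> times the monic orthogonal polynomial of degree
  \<open>m - 2\<close>. Norms and matrix elements involve only this product, so the quotient by
  \<open>q\<close> never has to be computed.\<close>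

definition lifted_poly :: "nat \<Rightarrow> complex poly" where
  "lifted_poly m = monom 1 m + (\<Sum>i<m. monom (of_real (low_coeff m i)) i)"

lemma coeff_lifted_poly:
  "coeff (lifted_poly m) i = of_real (if i < m then low_coeff m i else if i = m then 1 else 0)"
  by (auto simp: lifted_poly_def coeff_sum)

lemma degree_lifted_poly: "degree (lifted_poly m) = m"
  by (rule antisym) (auto intro!: degree_le le_degree simp: coeff_lifted_poly)

lemma poly_lifted_poly: "poly (lifted_poly m) x = x ^ m + (\<Sum>i<m. of_real (low_coeff m i) * x ^ i)"
  by (simp add: lifted_poly_def poly_sum poly_monom)

lemma arc_poly_dvd_lifted_poly:
  assumes "m \<ge> 2"
  shows "arc_poly dvd lifted_poly m"
proof -
  have root: "poly (lifted_poly m) (cis s) = 0" if st: "s = t \<or> s = - t" for s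
  proof (rule complex_eqI)
    have c: "cos (real i * s) = cos (real i * t + 0)" for i using that by auto
    \<comment> \<open>\<open>e\<close> is the sign of the sine under \<open>s = t\<close> or
      \<open>s = - t\<close>. Writing the sine as a cosine with phase -pi/2 makes the imaginary part
      another instance of \<open>sum_low_coeff_cos\<close>.\<close>
    obtain e where s: "sin (real i * s) = e * cos (real i * t + - (pi / 2))" for i :: nat
    proof
      show "sin (real i * s) = (if s = t then 1 else - 1) * cos (real i * t + - (pi / 2))" for i :: nat
        using st by (auto simp: cos_diff)
    qed
    show "Re (poly (lifted_poly m) (cis s)) = Re 0"
      using sum_low_coeff_cos[OF assms, of 0] unfolding c
      by (simp add: poly_lifted_poly Complex.DeMoivre c)
    have "Im (poly (lifted_poly m) (cis s)) = e * (cos (real m * t + - (pi / 2)) +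
            (\<Sum>i<m. low_coeff m i * cos (real i * t + - (pi / 2))))"
      by (simp add: poly_lifted_poly Complex.DeMoivre s sum_distrib_left distrib_left mult.left_commute)
    then show "Im (poly (lifted_poly m) (cis s)) = Im 0"
      unfolding sum_low_coeff_cos[OF assms] by simp
  qed
  show ?thesis unfolding arc_poly_dvd_iff using root by auto
qed

text \<open>The reproducing property of the kernels: \<open>cos (i t + y)\<close> combines the
  powers of \<open>cis t\<close> and \<open>cis (- t)\<close>, so the sum is a combination of the
  values of \<open>f\<close> at its two zeros.\<close>

lemma sum_cos_coeff_eq_0:
  assumes "arc_poly dvd f" "degree f < m"
  shows "(\<Sum>i<m. of_real (cos (real i * t + y)) * coeff f i) = 0"
proof -
  have poly: "poly f x = (\<Sum>i<m. coeff f i * x ^ i)" for x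
    unfolding poly_altdef using assms(2) by (intro sum.mono_neutral_left) (auto simp: coeff_eq_0)
  have cos: "complex_of_real (cos (real i * t + y)) = (cis y * cis t ^ i + cis (- y) * cis (- t) ^ i) / 2" for i
  proof -
    have "cis y * cis t ^ i = cis (real i * t + y)" "cis (- y) * cis (- t) ^ i = cis (- (real i * t + y))"
      by (simp_all add: Complex.DeMoivre cis_mult add.commute)
    moreover have "complex_of_real (cos x) = (cis x + cis (- x)) / 2" for x
      by (simp add: complex_eq_iff)
    ultimately show ?thesis by simp
  qed
  have "(\<Sum>i<m. of_real (cos (real i * t + y)) * coeff f i) =
        (cis y * poly f (cis t) + cis (- y) * poly f (cis (- t))) / 2"
    unfolding poly cos sum_distrib_left sum.distrib[symmetric] sum_divide_distrib
    by (intro sum.cong) (auto simp: field_simps)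
  then show ?thesis using assms(1) by (simp add: arc_poly_dvd_iff)
qed

text \<open>The leading monomial lies above the degree of \<open>f\<close>, and the lower part is a
  combination of kernels, which only see \<open>f\<close> at the zeros of \<open>q\<close>.\<close>

lemma coeff_inner_lifted_poly_eq_0:
  assumes "arc_poly dvd f" "degree f < m"
  shows "coeff_inner f (lifted_poly m) = 0"
proof -
  have "coeff_inner f (lifted_poly m) = (\<Sum>i\<le>m - 1. coeff f i * cnj (coeff (lifted_poly m) i))"
    using assms(2) by (intro coeff_inner_eq_sum) auto
  also have "\<dots> = (\<Sum>i<m. coeff f i * of_real (low_coeff m i))"
    using assms(2) by (intro sum.cong) (auto simp: coeff_lifted_poly)
  also have "\<dots> = - of_real (kernel_scale m) *
     (of_real (real m) * (\<Sum>i<m. of_real (cos (real i * t + (- real m * t))) * coeff f i)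
      - of_real (sin_quot m) * (\<Sum>i<m. of_real (cos (real i * t + t)) * coeff f i))"
    by (simp add: low_coeff_def sum_distrib_left sum_subtractf sum_negf algebra_simps)
  finally show ?thesis unfolding sum_cos_coeff_eq_0[OF assms] by simp
qed

definition norm_square_lifted :: "nat \<Rightarrow> real" where
  "norm_square_lifted m = 1 + kernel_scale m * (real m - sin_quot m * cos (real m * t + t))"

lemma coeff_inner_lifted_poly_self:
  assumes "m \<ge> 2"
  shows "coeff_inner (lifted_poly m) (lifted_poly m) = of_real (norm_square_lifted m)"
proof -
  have "(\<Sum>i\<le>m. (norm (coeff (lifted_poly m) i))\<^sup>2) = 1 + (\<Sum>i<m. (low_coeff m i)\<^sup>2)"
    by (simp add: lessThan_Suc_atMost[symmetric] coeff_lifted_poly)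
  then show ?thesis
    by (simp add: coeff_inner_self degree_lifted_poly norm_square_lifted_def sum_low_coeff_square[OF assms])
qed

lemma norm_square_lifted_pos:
  assumes "m \<ge> 2"
  shows "norm_square_lifted m > 0"
proof -
  have "norm_square_lifted m = 1 + (\<Sum>i<m. (low_coeff m i)\<^sup>2)"
    by (simp add: norm_square_lifted_def sum_low_coeff_square[OF assms])
  also have "\<dots> > 0" by (intro add_pos_nonneg sum_nonneg) auto
  finally show ?thesis .
qed

definition arc_norm_square :: real where
  "arc_norm_square = 2 + (2 * cos t)\<^sup>2"

lemma coeff_inner_arc_poly: "coeff_inner arc_poly arc_poly = of_real arc_norm_square"
proof -
  have "(\<Sum>i\<le>degree arc_poly. (norm (coeff arc_poly i))\<^sup>2) = arc_norm_square"
    by (simp add: degree_arc_poly arc_norm_square_def)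
       (simp add: arc_poly_def numeral_2_eq_2 norm_mult power_mult_distrib)
  then show ?thesis by (simp only: coeff_inner_self)
qed

lemma arc_norm_square_pos: "arc_norm_square > 0"
  by (simp add: arc_norm_square_def add_pos_nonneg)

text \<open>The leading coefficient of the orthonormal polynomial. \<open>arc_norm_square\<close>
  appears because the measure is normalized by the squared norm of \<open>q\<close>.\<close>

definition norming :: "nat \<Rightarrow> real" where
  "norming n = sqrt (arc_norm_square / norm_square_lifted (n + 2))"

definition arc_onp :: "nat \<Rightarrow> complex poly" where
  "arc_onp n = smult (of_real (norming n)) (lifted_poly (n + 2) div arc_poly)"

lemma arc_poly_mult_onp: "arc_poly * arc_onp n = smult (of_real (norming n)) (lifted_poly (n + 2))"
  using arc_poly_dvd_lifted_poly[of "n + 2"] by (simp add: arc_onp_def)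

lemma norming_pos: "norming n > 0"
  using norm_square_lifted_pos[of "n + 2"] arc_norm_square_pos by (simp add: norming_def)

lemma norming_square: "(norming n)\<^sup>2 = arc_norm_square / norm_square_lifted (n + 2)"
  using norm_square_lifted_pos[of "n + 2"] arc_norm_square_pos by (simp add: norming_def)

lemma degree_arc_onp: "degree (arc_onp n) = n"
  and lead_coeff_arc_onp: "lead_coeff (arc_onp n) = of_real (norming n)"
proof -
  have "arc_onp n \<noteq> 0"
    using arc_poly_mult_onp[of n] norming_pos[of n] degree_lifted_poly[of "n + 2"] by fastforce
  then have "degree (arc_poly * arc_onp n) = 2 + degree (arc_onp n)"
    by (simp add: degree_mult_eq arc_poly_neq_0 degree_arc_poly)
  then show "degree (arc_onp n) = n"
    unfolding arc_poly_mult_onp using norming_pos[of n] by (simp add: degree_lifted_poly)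
  have "lead_coeff (arc_poly * arc_onp n) = lead_coeff (arc_onp n)"
    unfolding lead_coeff_mult by (simp add: arc_poly_def)
  then show "lead_coeff (arc_onp n) = of_real (norming n)"
    unfolding arc_poly_mult_onp using norming_pos[of n] by (simp add: degree_lifted_poly coeff_lifted_poly)
qed

lemma coeff_inner_arc_onp:
  "coeff_inner (arc_poly * arc_onp m) (arc_poly * arc_onp n) / of_real arc_norm_square = (if m = n then 1 else 0)"
proof -
  have less_eq_0: "coeff_inner (lifted_poly (m + 2)) (lifted_poly (n + 2)) = 0" if "m < n" for m n
    by (rule coeff_inner_lifted_poly_eq_0) (use that in \<open>auto simp: degree_lifted_poly intro!: arc_poly_dvd_lifted_poly\<close>)
  show ?thesis
  proof (cases m n rule: linorder_cases)
    case less
    then have "coeff_inner (lifted_poly (m + 2)) (lifted_poly (n + 2)) = 0" by (rule less_eq_0)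
    then show ?thesis
      using less unfolding arc_poly_mult_onp coeff_inner_smult_left coeff_inner_smult_right by simp
  next
    case greater
    then have "coeff_inner (lifted_poly (m + 2)) (lifted_poly (n + 2)) = 0"
      by (subst coeff_inner_commute) (simp only: less_eq_0 complex_cnj_zero)
    then show ?thesis
      using greater unfolding arc_poly_mult_onp coeff_inner_smult_left coeff_inner_smult_right by simp
  next
    case equal
    have "coeff_inner (arc_poly * arc_onp n) (arc_poly * arc_onp n) = of_real ((norming n)\<^sup>2 * norm_square_lifted (n + 2))"
      unfolding arc_poly_mult_onp coeff_inner_smult_left coeff_inner_smult_right
      by (subst coeff_inner_lifted_poly_self) (auto simp: power2_eq_square)
    also have "(norming n)\<^sup>2 * norm_square_lifted (n + 2) = arc_norm_square"
      using norm_square_lifted_pos[of "n + 2"] by (simp add: norming_square)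
    finally show ?thesis using arc_norm_square_pos equal by simp
  qed
qed

end

subsection \<open>Matrix elements\<close>

lemma homogenize_mult:
  assumes "degree f \<le> a" "degree g \<le> b"
  shows "homogenize (a + b) (f * g) z w = homogenize a f z w * homogenize b g z w"
proof (cases "w = 0")
  case False
  have "degree (f * g) \<le> a + b" using assms degree_mult_le[of f g] by linarith
  then show ?thesis using False assms by (simp add: homogenize_eq power_add)
next
  case True
  have at_0: "homogenize n h z 0 = coeff h n * z ^ n" for n h
  proof -
    have "homogenize n h z 0 = (\<Sum>i\<le>n. if i = n then coeff h i * z ^ i else 0)"
      unfolding homogenize_def by (intro sum.cong) auto
    then show ?thesis by simp
  qed
  have "coeff (f * g) (a + b) = (\<Sum>i\<le>a + b. if i = a then coeff f a * coeff g b else 0)"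
    unfolding coeff_mult
  proof (intro sum.cong refl)
    fix i assume "i \<in> {..a + b}"
    show "coeff f i * coeff g (a + b - i) = (if i = a then coeff f a * coeff g b else 0)"
    proof (cases i a rule: linorder_cases)
      case less
      then have "degree g < a + b - i" using assms by linarith
      then show ?thesis using less by (simp add: coeff_eq_0)
    next
      case greater
      then show ?thesis using assms by (simp add: coeff_eq_0)
    qed simp
  qed
  then show ?thesis using True by (simp add: at_0 power_add)
qed

lemma homogenize_one: "homogenize k 1 z w = w ^ k"
proof -
  have "homogenize k 1 z w = (\<Sum>i\<le>k. if i = 0 then w ^ k else 0)"
    unfolding homogenize_def by (intro sum.cong) auto
  then show ?thesis by simp
qed

lemma homogenize_monom: "homogenize k (monom 1 k) z w = z ^ k"
proof -
  have "homogenize k (monom 1 k) z w = (\<Sum>i\<le>k. if i = k then z ^ k else 0)"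
    unfolding homogenize_def by (intro sum.cong) auto
  then show ?thesis by simp
qed

lemma homogenize_smult: "homogenize n (smult c f) z w = c * homogenize n f z w"
  by (simp add: homogenize_def sum_distrib_left mult.assoc)

lemma hardy_inner_homogenize:
  "hardy_inner (homogenize d f) (homogenize e g) =
     (if d = e then \<Sum>i\<le>d. coeff f i * cnj (coeff g i) else 0)"
proof -
  have "homogenize n h = (\<lambda>z w. \<Sum>i\<le>n. coeff h i * z ^ i * w ^ (n - i))" for n h
    by (simp add: fun_eq_iff homogenize_def)
  then show ?thesis by (simp only: hardy_inner_homogeneous)
qed

lemma coeff_poly_star:
  "coeff (poly_star f) i = (if i \<le> degree f then cnj (coeff f (degree f - i)) else 0)"
  by (auto simp: poly_star_def coeff_map_poly coeff_reflect_poly)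

lemma poly_star_mult: "poly_star (f * g) = poly_star f * poly_star g"
proof -
  have "map_poly cnj (f * g) = map_poly cnj f * map_poly cnj g" for f g
    by (rule poly_eqI) (simp add: coeff_map_poly coeff_mult)
  then show ?thesis by (simp add: poly_star_def reflect_poly_mult)
qed

lemma poly_star_smult: "poly_star (smult c f) = smult (cnj c) (poly_star f)"
  by (simp add: poly_star_def reflect_poly_smult map_poly_smult)

context arc_weight
begin

definition arc_form :: "complex \<Rightarrow> complex \<Rightarrow> complex" where
  "arc_form z w = z\<^sup>2 - of_real (2 * cos t) * z * w + w\<^sup>2"

lemma arc_form_eq_homogenize: "arc_form = homogenize 2 arc_poly"
  by (simp add: fun_eq_iff arc_form_def homogenize_def arc_poly_def numeral_2_eq_2 algebra_simps)

lemma arc_form_eq_poly: "arc_form \<zeta> 1 = poly arc_poly \<zeta>"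
  by (simp add: arc_form_def arc_poly_def power2_eq_square algebra_simps)

lemma hardy_norm_arc_form: "hardy_norm arc_form = sqrt arc_norm_square"
proof -
  have "hardy_inner arc_form arc_form = coeff_inner arc_poly arc_poly"
    by (simp only: arc_form_eq_homogenize hardy_inner_homogenize coeff_inner_def degree_arc_poly if_True refl)
  then show ?thesis by (simp add: hardy_norm_def coeff_inner_arc_poly)
qed

lemma onp_arc_form: "onp (circle_measure arc_form) = arc_onp"
proof (rule onp_circle_measure_eq[of arc_form arc_poly, OF arc_form_eq_poly arc_poly_neq_0])
  have "\<exists>\<kappa>>0. lead_coeff (arc_onp n) = complex_of_real \<kappa>" for n
    using lead_coeff_arc_onp norming_pos by blast
  then show "orthonormal_polys (circle_measure arc_form) arc_onp"
    unfolding orthonormal_polys_def integral_circle_measure[of arc_form arc_poly, OF arc_form_eq_poly] coeff_inner_arc_poly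
      coeff_inner_arc_onp
    using degree_arc_onp by blast
qed

text \<open>The coefficients of \<open>q\<close> are real and palindromic. Hence \<open>q\<close>
  times the star of an orthonormal polynomial is the star of the product, and \<open>basis_e\<close>
  carries the reversed coefficients of \<open>basis_f\<close>.\<close>

lemma poly_star_arc_poly: "poly_star arc_poly = arc_poly"
proof (rule poly_eqI)
  fix i :: nat
  consider "i = 0" | "i = 1" | "i = 2" | "i > 2" by linarith
  then show "coeff (poly_star arc_poly) i = coeff arc_poly i"
    by cases (simp_all add: coeff_poly_star degree_arc_poly coeff_eq_0,
              simp_all add: arc_poly_def numeral_2_eq_2)
qed

text \<open>The norm of \<open>q\<close> cancels between \<open>norming\<close> and the Hardy norm
  of the generator, so the basis functions are lifted polynomials normalized by their own
  coefficient norm.\<close>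

definition basis_scale :: "nat \<Rightarrow> real" where
  "basis_scale n = norming n / sqrt arc_norm_square"

lemma basis_scale_square: "(basis_scale n)\<^sup>2 = 1 / norm_square_lifted (n + 2)"
  using arc_norm_square_pos by (simp add: basis_scale_def power_divide norming_square)

lemma basis_e_arc_form:
  "w ^ k * basis_e arc_form n z w =
     homogenize (n + 2 + k) (smult (of_real (basis_scale n)) (poly_star (lifted_poly (n + 2)))) z w"
proof -
  have deg: "degree (poly_star f) \<le> degree f" for f
    by (rule degree_le) (simp add: coeff_poly_star)
  have "poly_star (arc_poly * arc_onp n) = smult (of_real (norming n)) (poly_star (lifted_poly (n + 2)))"
    unfolding arc_poly_mult_onp poly_star_smult by simp
  then have 1: "arc_poly * poly_star (arc_onp n) = smult (of_real (norming n)) (poly_star (lifted_poly (n + 2)))"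
    by (simp only: poly_star_mult poly_star_arc_poly)
  have "arc_form z w * homogenize n (poly_star (arc_onp n)) z w =
        homogenize (2 + n) (arc_poly * poly_star (arc_onp n)) z w"
    unfolding arc_form_eq_homogenize
    by (rule homogenize_mult[symmetric]) (use deg[of "arc_onp n"] in \<open>auto simp: degree_arc_poly degree_arc_onp\<close>)
  then have 2: "basis_e arc_form n z w =
      of_real (basis_scale n) * homogenize (n + 2) (poly_star (lifted_poly (n + 2))) z w"
    unfolding basis_e_def hardy_norm_arc_form onp_arc_form 1 homogenize_smult basis_scale_def
    by (simp add: add.commute)
  have "homogenize (n + 2 + k) (poly_star (lifted_poly (n + 2)) * 1) z w =
        homogenize (n + 2) (poly_star (lifted_poly (n + 2))) z w * homogenize k 1 z w"
    by (rule homogenize_mult) (use deg[of "lifted_poly (n + 2)"] in \<open>auto simp: degree_lifted_poly\<close>)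
  then show ?thesis unfolding 2 homogenize_smult homogenize_one by simp
qed

lemma basis_f_arc_form:
  "z ^ k * basis_f arc_form n z w =
     homogenize (n + 2 + k) (smult (of_real (basis_scale n)) (monom 1 k * lifted_poly (n + 2))) z w"
proof -
  have "arc_form z w * homogenize n (arc_onp n) z w = homogenize (2 + n) (arc_poly * arc_onp n) z w"
    unfolding arc_form_eq_homogenize
    by (rule homogenize_mult[symmetric]) (auto simp: degree_arc_poly degree_arc_onp)
  then have 2: "basis_f arc_form n z w =
      of_real (basis_scale n) * homogenize (n + 2) (lifted_poly (n + 2)) z w"
    unfolding basis_f_def hardy_norm_arc_form onp_arc_form arc_poly_mult_onp homogenize_smult basis_scale_def
    by (simp add: add.commute)
  have "homogenize (k + (n + 2)) (monom 1 k * lifted_poly (n + 2)) z w =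
        homogenize k (monom 1 k) z w * homogenize (n + 2) (lifted_poly (n + 2)) z w"
    by (rule homogenize_mult) (auto simp: degree_lifted_poly degree_monom_eq)
  then show ?thesis unfolding 2 homogenize_smult homogenize_monom by (simp add: add_ac)
qed

text \<open>The guard \<open>k \<le> m\<close> matters: with truncated subtraction the sum over
  \<open>i \<le> m - k\<close> would keep the term \<open>i = 0\<close> when \<open>k > m\<close>,
  where the matrix element is zero.\<close>

definition overlap :: "nat \<Rightarrow> nat \<Rightarrow> real" where
  "overlap k m = (if k \<le> m then \<Sum>i\<le>m - k. low_coeff m i * low_coeff m (m - k - i) else 0) / norm_square_lifted m"

text \<open>Total degrees force \<open>j = n\<close>. The star reverses coefficients,
  \<open>z ^ k\<close> shifts them by \<open>k\<close> and \<open>w ^ k\<close> only raises the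
  degree, so the pairing is a self-convolution at total index \<open>m - k\<close>. As
  \<open>k \<ge> 1\<close>, both indices stay below \<open>m\<close> and the leading coefficient 1
  never enters.\<close>

lemma hardy_inner_basis_arc_form:
  assumes "k \<ge> 1"
  shows "hardy_inner (\<lambda>z w. w ^ k * basis_e arc_form j z w) (\<lambda>z w. z ^ k * basis_f arc_form n z w) =
     (if j = n then of_real (overlap k (n + 2)) else 0)"
proof -
  define m where "m = n + 2"
  define L where "L = (\<lambda>i. if i < m then low_coeff m i else if i = m then 1 else 0)"
  have L: "coeff (lifted_poly m) i = of_real (L i)" for i by (simp add: coeff_lifted_poly L_def)
  have inner: "hardy_inner (\<lambda>z w. w ^ k * basis_e arc_form j z w) (\<lambda>z w. z ^ k * basis_f arc_form n z w) =
     (if j = n then \<Sum>i\<le>m + k. coeff (smult (of_real (basis_scale n)) (poly_star (lifted_poly m))) i *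
        cnj (coeff (smult (of_real (basis_scale n)) (monom 1 k * lifted_poly m)) i) else 0)"
    unfolding basis_e_arc_form basis_f_arc_form
    using hardy_inner_homogenize[of "j + 2 + k" "smult (of_real (basis_scale j)) (poly_star (lifted_poly (j + 2)))"
      "n + 2 + k" "smult (of_real (basis_scale n)) (monom 1 k * lifted_poly (n + 2))"]
    by (auto simp: m_def)
  have "(\<Sum>i\<le>m + k. coeff (smult (of_real (basis_scale n)) (poly_star (lifted_poly m))) i *
        cnj (coeff (smult (of_real (basis_scale n)) (monom 1 k * lifted_poly m)) i)) =
     (\<Sum>i\<le>m + k. of_real ((basis_scale n)\<^sup>2 * (if k \<le> i \<and> i \<le> m then L (m - i) * L (i - k) else 0)))"
    by (intro sum.cong) (auto simp: coeff_poly_star degree_lifted_poly coeff_monom_mult L power2_eq_square)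
  also have "\<dots> = of_real ((basis_scale n)\<^sup>2 * (\<Sum>i\<le>m + k. if k \<le> i \<and> i \<le> m then L (m - i) * L (i - k) else 0))"
    by (simp only: of_real_sum sum_distrib_left)
  also have "(\<Sum>i\<le>m + k. if k \<le> i \<and> i \<le> m then L (m - i) * L (i - k) else 0) = (\<Sum>i\<in>{k..m}. L (m - i) * L (i - k))"
    by (simp add: sum.If_cases) (rule sum.cong, auto)
  also have "\<dots> = (if k \<le> m then \<Sum>i\<le>m - k. low_coeff m i * low_coeff m (m - k - i) else 0)"
  proof (cases "k \<le> m")
    case True
    have "(\<Sum>i\<in>{k..m}. L (m - i) * L (i - k)) = (\<Sum>i\<le>m - k. L i * L (m - k - i))"
      by (rule sum.reindex_bij_witness[of _ "\<lambda>i. m - i" "\<lambda>i. m - i"]) (use True in auto)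
    also have "\<dots> = (\<Sum>i\<le>m - k. low_coeff m i * low_coeff m (m - k - i))"
      by (intro sum.cong) (use True assms in \<open>auto simp: L_def\<close>)
    finally show ?thesis using True by simp
  qed simp
  finally show ?thesis unfolding inner by (simp add: basis_scale_square overlap_def m_def)
qed

lemma Sigma_gen_arc_form:
  assumes "k \<ge> 1"
  shows "Sigma_gen arc_form k = (\<Sum>n. ennreal ((overlap k (n + 2))\<^sup>2))"
proof -
  define g where "g = (\<lambda>n. ennreal ((overlap k (n + 2))\<^sup>2))"
  have "Sigma_gen arc_form k = (\<Sum>\<^sub>\<infinity>(j, n)\<in>UNIV. if j = n then g n else 0)"
    unfolding Sigma_gen_def hardy_inner_basis_arc_form[OF assms] g_def
    by (intro infsum_cong) auto
  also have "\<dots> = (\<Sum>\<^sub>\<infinity>(j, n)\<in>range (\<lambda>n. (n, n)). if j = n then g n else 0)"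
    by (rule infsum_cong_neutral) auto
  also have "\<dots> = (\<Sum>\<^sub>\<infinity>n\<in>UNIV. g n)"
    by (subst infsum_reindex) (auto simp: inj_on_def o_def)
  also have "\<dots> = (\<Sum>n. g n)"
    by (intro sums_unique has_sum_imp_sums has_sum_infsum nonneg_summable_on_complete) simp
  finally show ?thesis unfolding g_def .
qed

end

subsection \<open>Closed forms\<close>

context arc_weight
begin

lemma kernel_scale_pos: "m \<ge> 2 \<Longrightarrow> kernel_scale m > 0"
  using sin_quot_square_less by (simp add: kernel_scale_def)

lemma norm_square_lifted_ge_1:
  assumes "m \<ge> 2"
  shows "norm_square_lifted m \<ge> 1"
proof -
  have "(\<Sum>i<m. (low_coeff m i)\<^sup>2) \<ge> 0" by (intro sum_nonneg) auto
  then show ?thesis by (simp add: norm_square_lifted_def sum_low_coeff_square[OF assms])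
qed

lemma abs_low_coeff_le:
  assumes "m \<ge> 2" "\<bar>sin_quot m\<bar> \<le> b" "b < real m"
  shows "\<bar>low_coeff m i\<bar> \<le> 2 / (real m - b)"
proof -
  let ?s = "\<bar>sin_quot m\<bar>"
  have "\<bar>real m * cos (real i * t - real m * t) - sin_quot m * cos (real i * t + t)\<bar>
      \<le> \<bar>real m * cos (real i * t - real m * t)\<bar> + \<bar>sin_quot m * cos (real i * t + t)\<bar>"
    by (rule abs_triangle_ineq4)
  also have "\<dots> \<le> real m * 1 + ?s * 1"
    unfolding abs_mult by (intro add_mono mult_mono) auto
  finally have "\<bar>low_coeff m i\<bar> \<le> kernel_scale m * (real m + ?s)"
    unfolding low_coeff_def abs_mult using kernel_scale_pos[OF assms(1)] by (simp add: mult_left_mono)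
  also have "\<dots> = 2 / (real m - ?s)"
  proof -
    have "(real m)\<^sup>2 - (sin_quot m)\<^sup>2 = (real m - ?s) * (real m + ?s)"
      by (simp add: algebra_simps power2_eq_square)
    moreover have "real m + ?s > 0" using assms by linarith
    moreover have "2 / (A * B) * B = 2 / A" if "B > 0" for A B :: real using that by simp
    ultimately show ?thesis by (simp only: kernel_scale_def)
  qed
  also have "\<dots> \<le> 2 / (real m - b)"
    using assms by (intro divide_left_mono mult_pos_pos) auto
  finally show ?thesis .
qed

text \<open>A crude bound of order 1/m, used for summability of the squares; \<open>b\<close> stands
  for a bound on \<open>sin_quot\<close> that does not grow with \<open>m\<close>.\<close>

lemma abs_overlap_le:
  assumes "m \<ge> 2" "\<bar>sin_quot m\<bar> \<le> b" "b < real m"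
  shows "\<bar>overlap k m\<bar> \<le> real (m + 1) * (2 / (real m - b))\<^sup>2"
proof (cases "k \<le> m")
  case True
  have "\<bar>\<Sum>i\<le>m - k. low_coeff m i * low_coeff m (m - k - i)\<bar> \<le> (\<Sum>i\<le>m - k. \<bar>low_coeff m i\<bar> * \<bar>low_coeff m (m - k - i)\<bar>)"
    by (rule order_trans[OF sum_abs]) (simp add: abs_mult)
  also have "\<dots> \<le> (\<Sum>i\<le>m - k. (2 / (real m - b))\<^sup>2)"
    unfolding power2_eq_square using assms by (intro sum_mono mult_mono abs_low_coeff_le) auto
  also have "\<dots> \<le> real (m + 1) * (2 / (real m - b))\<^sup>2"
    by (auto intro!: mult_right_mono)
  finally have "\<bar>\<Sum>i\<le>m - k. low_coeff m i * low_coeff m (m - k - i)\<bar> / norm_square_lifted m \<le>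
     real (m + 1) * (2 / (real m - b))\<^sup>2 / 1"
    using norm_square_lifted_ge_1[OF assms(1)] by (intro frac_le) auto
  then show ?thesis
    using True norm_square_lifted_ge_1[OF assms(1)] by (simp add: overlap_def abs_divide)
qed (simp add: overlap_def)

lemma overlap_closed_form:
  assumes "m \<ge> 2" "m \<ge> k"
  defines "s \<equiv> sin_quot m" and "S \<equiv> sin_quot (m - k + 1)"
  shows "overlap k m = 2 *
     ((real m)\<^sup>2 * ((real m - real k + 1) * cos ((real m + real k) * t) + S)
      - 2 * real m * s * ((real m - real k + 1) * cos ((real k - 1) * t) + cos ((real m + 1) * t) * S)
      + s\<^sup>2 * ((real m - real k + 1) * cos ((real m - real k + 2) * t) + S)) /
     (((real m)\<^sup>2 - s\<^sup>2) * ((real m)\<^sup>2 - s\<^sup>2 + 2 * (real m - s * cos ((real m + 1) * t))))"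
proof -
  define X where "X = (real m)\<^sup>2 * ((real m - real k + 1) * cos ((real m + real k) * t) + S)
      - 2 * real m * s * ((real m - real k + 1) * cos ((real k - 1) * t) + cos ((real m + 1) * t) * S)
      + s\<^sup>2 * ((real m - real k + 1) * cos ((real m - real k + 2) * t) + S)"
  define E where "E = (real m)\<^sup>2 - s\<^sup>2"
  define Y where "Y = real m - s * cos ((real m + 1) * t)"
  have E: "E > 0" unfolding E_def s_def using sin_quot_square_less[OF assms(1)] by simp
  have norm: "norm_square_lifted m = (E + 2 * Y) / E"
    using E by (simp add: norm_square_lifted_def kernel_scale_def E_def s_def Y_def field_simps)
  have "overlap k m = (2 / E)\<^sup>2 / 2 * X / ((E + 2 * Y) / E)"
    unfolding overlap_def sum_low_coeff_convolution[OF assms(2)] norm[symmetric]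
    using assms(2) by (simp add: kernel_scale_def E_def X_def s_def S_def)
  also have "\<dots> = 2 * X / (E * (E + 2 * Y))"
    \<comment> \<open>One factor \<open>E\<close> cancels; if \<open>E + 2 * Y\<close> were zero,
      both quotients would be 0 by convention.\<close>
    using E by (cases "E + 2 * Y = 0") (auto simp: field_simps power2_eq_square)
  finally show ?thesis unfolding X_def E_def Y_def .
qed

end

section \<open>Specialization to the angle pi / 6\<close>

interpretation sixth: arc_weight "pi / 6"
  by standard (simp add: sin_30)

lemma cos_add_pi_sixth:
  shows "cos (x + pi / 6) = sqrt 3 / 2 * cos x - sin x / 2"
    and "cos (x + pi / 2) = - sin x"
    and "cos (x + 2 * pi / 3) = - cos x / 2 - sqrt 3 / 2 * sin x"
    and "cos (x - pi / 6) = sqrt 3 / 2 * cos x + sin x / 2"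
    and "cos (x - pi / 3) = cos x / 2 + sqrt 3 / 2 * sin x"
    and "sin (x - pi / 3) = sin x / 2 - sqrt 3 / 2 * cos x"
    and "sin (x - pi / 2) = - cos x"
  by (simp_all add: cos_add cos_diff sin_diff cos_30 sin_30 cos_60 sin_60 cos_120 sin_120)

lemma sixth_sin_quot: "sixth.sin_quot m = 2 * sin (real m * (pi / 6))"
  by (simp add: sixth.sin_quot_def sin_30)

text \<open>Numerators and denominator of the matrix elements as polynomials in \<open>x = n + 2\<close>, with \<open>q\<close> standing for \<open>sqrt 3\<close> and \<open>d\<close>, \<open>s\<close> for twice the cosine and the sine of \<open>x * pi / 6\<close>.\<close>

definition overlap_3_num :: "real \<Rightarrow> real \<Rightarrow> real \<Rightarrow> real \<Rightarrow> real" where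
  "overlap_3_num q x d s = 2 * x\<^sup>2 * ((3 - x) * s - q * d) - x * s * (4 * (x - 2) - (s - q * d)\<^sup>2)
     + s\<^sup>2 * ((x - 2) * (q * d + s) + 2 * (s - q * d))"

definition overlap_4_num :: "real \<Rightarrow> real \<Rightarrow> real \<Rightarrow> real \<Rightarrow> real" where
  "overlap_4_num q x d s = (s\<^sup>2 - x\<^sup>2) * (x - 3) * (d + q * s) - 4 * d * (x\<^sup>2 + s\<^sup>2) + 2 * x * s * d * (q * d - s)"

definition overlap_den :: "real \<Rightarrow> real \<Rightarrow> real \<Rightarrow> real \<Rightarrow> real" where
  "overlap_den q x d s = (x\<^sup>2 - s\<^sup>2) * (2 * x\<^sup>2 - 2 * s\<^sup>2 + 4 * x - s * (q * d - s))"

lemma overlap_3_closed_form: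
  assumes "m \<ge> 3"
  defines "x \<equiv> real m" and "c \<equiv> cos (real m * (pi / 6))" and "s \<equiv> 2 * sin (real m * (pi / 6))"
  shows "sixth.overlap 3 m = overlap_3_num (sqrt 3) x (2 * c) s / overlap_den (sqrt 3) x (2 * c) s"
proof -
  let ?a = "real m * (pi / 6)"
  have 1: "cos ((real m + real 3) * (pi / 6)) = - s / 2"
  proof -
    have "(real m + real 3) * (pi / 6) = ?a + pi / 2" by (simp add: field_simps)
    then show ?thesis by (simp only: cos_add_pi_sixth s_def c_def)
  qed
  have 2: "sixth.sin_quot (m - 3 + 1) = s / 2 - sqrt 3 * c"
  proof -
    have "real (m - 3 + 1) * (pi / 6) = ?a - pi / 3" using assms(1) by (simp add: of_nat_diff field_simps)
    then show ?thesis by (simp only: sixth_sin_quot cos_add_pi_sixth s_def c_def) (simp add: algebra_simps)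
  qed
  have 3: "cos ((real 3 - 1) * (pi / 6)) = 1 / 2" using cos_60 by simp
  have 4: "cos ((real m + 1) * (pi / 6)) = sqrt 3 / 2 * c - s / 4"
  proof -
    have "(real m + 1) * (pi / 6) = ?a + pi / 6" by (simp add: field_simps)
    then show ?thesis by (simp only: cos_add_pi_sixth s_def c_def)
  qed
  have 5: "cos ((real m - real 3 + 2) * (pi / 6)) = sqrt 3 / 2 * c + s / 4"
  proof -
    have "(real m - real 3 + 2) * (pi / 6) = ?a - pi / 6" by (simp add: field_simps)
    then show ?thesis by (simp only: cos_add_pi_sixth s_def c_def)
  qed
  have 6: "real m - real 3 + 1 = x - 2" by (simp add: x_def)
  have "sixth.overlap 3 m = 2 *
     (x\<^sup>2 * ((x - 2) * (- s / 2) + (s / 2 - sqrt 3 * c))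
      - 2 * x * s * ((x - 2) * (1 / 2) + (sqrt 3 / 2 * c - s / 4) * (s / 2 - sqrt 3 * c))
      + s\<^sup>2 * ((x - 2) * (sqrt 3 / 2 * c + s / 4) + (s / 2 - sqrt 3 * c))) /
     ((x\<^sup>2 - s\<^sup>2) * (x\<^sup>2 - s\<^sup>2 + 2 * (x - s * (sqrt 3 / 2 * c - s / 4))))" (is "_ = ?n / ?d")
    using sixth.overlap_closed_form[of m 3] assms(1)
    unfolding sixth_sin_quot[of m] s_def[symmetric] 1 2 3 4 5 6 x_def by simp
  \<comment> \<open>Doubling clears the remaining halves, so that both parts become polynomials with
    integer coefficients.\<close>
  also have "\<dots> = (2 * ?n) / (2 * ?d)"
    by (rule mult_divide_mult_cancel_left[symmetric]) simp
  also have "2 * ?n = overlap_3_num (sqrt 3) x (2 * c) s"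
    by (simp add: overlap_3_num_def algebra_simps power2_eq_square add_divide_distrib diff_divide_distrib)
  also have "2 * ?d = overlap_den (sqrt 3) x (2 * c) s"
    by (simp add: overlap_den_def algebra_simps power2_eq_square add_divide_distrib diff_divide_distrib)
  finally show ?thesis .
qed

lemma overlap_4_closed_form:
  assumes "m \<ge> 4"
  defines "x \<equiv> real m" and "c \<equiv> cos (real m * (pi / 6))" and "s \<equiv> 2 * sin (real m * (pi / 6))"
  shows "sixth.overlap 4 m = overlap_4_num (sqrt 3) x (2 * c) s / overlap_den (sqrt 3) x (2 * c) s"
proof -
  let ?a = "real m * (pi / 6)"
  have 1: "cos ((real m + real 4) * (pi / 6)) = - c / 2 - sqrt 3 / 4 * s"
  proof -
    have "(real m + real 4) * (pi / 6) = ?a + 2 * pi / 3" by (simp add: field_simps)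
    then show ?thesis by (simp only: cos_add_pi_sixth s_def c_def)
  qed
  have 2: "sixth.sin_quot (m - 4 + 1) = - 2 * c"
  proof -
    have "real (m - 4 + 1) * (pi / 6) = ?a - pi / 2" using assms(1) by (simp add: of_nat_diff field_simps)
    then show ?thesis by (simp only: sixth_sin_quot cos_add_pi_sixth c_def)
  qed
  have 3: "cos ((real 4 - 1) * (pi / 6)) = 0" by simp
  have 4: "cos ((real m + 1) * (pi / 6)) = sqrt 3 / 2 * c - s / 4"
  proof -
    have "(real m + 1) * (pi / 6) = ?a + pi / 6" by (simp add: field_simps)
    then show ?thesis by (simp only: cos_add_pi_sixth s_def c_def)
  qed
  have 5: "cos ((real m - real 4 + 2) * (pi / 6)) = c / 2 + sqrt 3 / 4 * s"
  proof -
    have "(real m - real 4 + 2) * (pi / 6) = ?a - pi / 3" by (simp add: field_simps)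
    then show ?thesis by (simp only: cos_add_pi_sixth s_def c_def)
  qed
  have 6: "real m - real 4 + 1 = x - 3" by (simp add: x_def)
  have "sixth.overlap 4 m = 2 *
     (x\<^sup>2 * ((x - 3) * (- c / 2 - sqrt 3 / 4 * s) + - 2 * c)
      - 2 * x * s * ((x - 3) * 0 + (sqrt 3 / 2 * c - s / 4) * (- 2 * c))
      + s\<^sup>2 * ((x - 3) * (c / 2 + sqrt 3 / 4 * s) + - 2 * c)) /
     ((x\<^sup>2 - s\<^sup>2) * (x\<^sup>2 - s\<^sup>2 + 2 * (x - s * (sqrt 3 / 2 * c - s / 4))))" (is "_ = ?n / ?d")
    using sixth.overlap_closed_form[of m 4] assms(1)
    unfolding sixth_sin_quot[of m] s_def[symmetric] 1 2 3 4 5 6 x_def by simp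
  also have "\<dots> = (2 * ?n) / (2 * ?d)"
    by (rule mult_divide_mult_cancel_left[symmetric]) simp
  also have "2 * ?n = overlap_4_num (sqrt 3) x (2 * c) s"
    by (simp add: overlap_4_num_def algebra_simps power2_eq_square add_divide_distrib diff_divide_distrib)
  also have "2 * ?d = overlap_den (sqrt 3) x (2 * c) s"
    by (simp add: overlap_den_def algebra_simps power2_eq_square add_divide_distrib diff_divide_distrib)
  finally show ?thesis .
qed

text \<open>Six steps of pi/6 make a half turn, so passing to the residue of \<open>m\<close> modulo
  6 costs only a sign common to sine and cosine.\<close>

lemma pi_sixth_angle:
  obtains e :: real where "e\<^sup>2 = 1"
    "cos (real m * (pi / 6)) = e * cos (real (m mod 6) * (pi / 6))"
    "sin (real m * (pi / 6)) = e * sin (real (m mod 6) * (pi / 6))"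
proof
  define j where "j = m div 6"
  have "real m = real (6 * j + m mod 6)" by (simp add: j_def)
  then have angle: "real m * (pi / 6) = real (m mod 6) * (pi / 6) + real j * pi" by (simp add: algebra_simps)
  show "cos (real m * (pi / 6)) = (- 1) ^ j * cos (real (m mod 6) * (pi / 6))"
    unfolding angle cos_add sin_npi cos_npi by simp
  show "sin (real m * (pi / 6)) = (- 1) ^ j * sin (real (m mod 6) * (pi / 6))"
    unfolding angle sin_add sin_npi cos_npi by simp
  show "((- 1 :: real) ^ j)\<^sup>2 = 1" by (simp add: power_mult[symmetric])
qed


lemma pi_sixth_values:
  shows "2 * cos (real 0 * (pi / 6)) = 2" "2 * sin (real 0 * (pi / 6)) = 0"
    "2 * cos (real 1 * (pi / 6)) = sqrt 3" "2 * sin (real 1 * (pi / 6)) = 1"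
    "2 * cos (real 2 * (pi / 6)) = 1" "2 * sin (real 2 * (pi / 6)) = sqrt 3"
    "2 * cos (real 3 * (pi / 6)) = 0" "2 * sin (real 3 * (pi / 6)) = 2"
    "2 * cos (real 4 * (pi / 6)) = - 1" "2 * sin (real 4 * (pi / 6)) = sqrt 3"
    "2 * cos (real 5 * (pi / 6)) = - sqrt 3" "2 * sin (real 5 * (pi / 6)) = 1"
proof -
  have "5 * pi / 6 = pi - pi / 6" by simp
  then have "cos (5 * pi / 6) = - (sqrt 3 / 2)" "sin (5 * pi / 6) = 1 / 2"
    by (simp_all only: cos_pi_minus sin_pi_minus cos_30 sin_30)
  then show "2 * cos (real 5 * (pi / 6)) = - sqrt 3" "2 * sin (real 5 * (pi / 6)) = 1"
    by simp_all
qed (use cos_120 sin_120 cos_60 sin_60 in \<open>simp_all add: cos_30 sin_30\<close>)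

text \<open>Keeping \<open>q\<close> as a variable with square 3 makes each evaluation a polynomial
  identity. The factor 2 is split off because it also occurs in \<open>overlap_den\<close> and
  cancels in the quotient.\<close>

lemma overlap_3_num_values:
  fixes q x :: real
  assumes "q\<^sup>2 = 3"
  shows "overlap_3_num q x (2) (0) = 2 * (q * (- 2 * x\<^sup>2))"
    "overlap_3_num q x (q) (1) = 2 * (8 * x - 2 * x\<^sup>2 - x^3 - 6)"
    "overlap_3_num q x (1) (q) = 2 * (q * (7 * x - x^3 - 6))"
    "overlap_3_num q x (0) (2) = 2 * (16 * x + 2 * x\<^sup>2 - 2 * x^3)"
    "overlap_3_num q x (- 1) (q) = 2 * (q * (6 + 10 * x + 2 * x\<^sup>2 - x^3))"
    "overlap_3_num q x (- q) (1) = 2 * (6 + 11 * x + 4 * x\<^sup>2 - x^3)"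
proof -
  have qq: "q * q = 3" "q * (q * y) = 3 * y" for y
    using assms by (simp_all add: power2_eq_square mult.assoc[symmetric])
  show "overlap_3_num q x (2) (0) = 2 * (q * (- 2 * x\<^sup>2))"
    "overlap_3_num q x (q) (1) = 2 * (8 * x - 2 * x\<^sup>2 - x^3 - 6)"
    "overlap_3_num q x (1) (q) = 2 * (q * (7 * x - x^3 - 6))"
    "overlap_3_num q x (0) (2) = 2 * (16 * x + 2 * x\<^sup>2 - 2 * x^3)"
    "overlap_3_num q x (- 1) (q) = 2 * (q * (6 + 10 * x + 2 * x\<^sup>2 - x^3))"
    "overlap_3_num q x (- q) (1) = 2 * (6 + 11 * x + 4 * x\<^sup>2 - x^3)"
    by (simp_all add: overlap_3_num_def power2_eq_square power3_eq_cube algebra_simps qq)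
qed

lemma overlap_4_num_values:
  fixes q x :: real
  assumes "q\<^sup>2 = 3"
  shows "overlap_4_num q x (2) (0) = 2 * (- x\<^sup>2 - x^3)"
    "overlap_4_num q x (q) (1) = 2 * (q * (3 * x + x\<^sup>2 - x^3 - 5))"
    "overlap_4_num q x (1) (q) = 2 * (6 * x + 4 * x\<^sup>2 - 2 * x^3 - 24)"
    "overlap_4_num q x (0) (2) = 2 * (q * (4 * x + 3 * x\<^sup>2 - x^3 - 12))"
    "overlap_4_num q x (- 1) (q) = 2 * (9 * x + 5 * x\<^sup>2 - x^3 - 3)"
    "overlap_4_num q x (- q) (1) = 2 * (q * (2 + 4 * x + 2 * x\<^sup>2))"
proof -
  have qq: "q * q = 3" "q * (q * y) = 3 * y" for y
    using assms by (simp_all add: power2_eq_square mult.assoc[symmetric])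
  show "overlap_4_num q x (2) (0) = 2 * (- x\<^sup>2 - x^3)"
    "overlap_4_num q x (q) (1) = 2 * (q * (3 * x + x\<^sup>2 - x^3 - 5))"
    "overlap_4_num q x (1) (q) = 2 * (6 * x + 4 * x\<^sup>2 - 2 * x^3 - 24)"
    "overlap_4_num q x (0) (2) = 2 * (q * (4 * x + 3 * x\<^sup>2 - x^3 - 12))"
    "overlap_4_num q x (- 1) (q) = 2 * (9 * x + 5 * x\<^sup>2 - x^3 - 3)"
    "overlap_4_num q x (- q) (1) = 2 * (q * (2 + 4 * x + 2 * x\<^sup>2))"
    by (simp_all add: overlap_4_num_def power2_eq_square power3_eq_cube algebra_simps qq)
qed

lemma overlap_den_values:
  fixes q x :: real
  assumes "q\<^sup>2 = 3"
  shows "overlap_den q x (2) (0) = 2 * ((x\<^sup>2) * (x\<^sup>2 + 2 * x))"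
    "overlap_den q x (q) (1) = 2 * ((x\<^sup>2 - 1) * (x\<^sup>2 + 2 * x - 2))"
    "overlap_den q x (1) (q) = 2 * ((x\<^sup>2 - 3) * (x\<^sup>2 + 2 * x - 3))"
    "overlap_den q x (0) (2) = 2 * ((x\<^sup>2 - 4) * (x\<^sup>2 + 2 * x - 2))"
    "overlap_den q x (- 1) (q) = 2 * ((x\<^sup>2 - 3) * (x\<^sup>2 + 2 * x))"
    "overlap_den q x (- q) (1) = 2 * ((x\<^sup>2 - 1) * (x\<^sup>2 + 2 * x + 1))"
proof -
  have qq: "q * q = 3" "q * (q * y) = 3 * y" for y
    using assms by (simp_all add: power2_eq_square mult.assoc[symmetric])
  show "overlap_den q x (2) (0) = 2 * ((x\<^sup>2) * (x\<^sup>2 + 2 * x))"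
    "overlap_den q x (q) (1) = 2 * ((x\<^sup>2 - 1) * (x\<^sup>2 + 2 * x - 2))"
    "overlap_den q x (1) (q) = 2 * ((x\<^sup>2 - 3) * (x\<^sup>2 + 2 * x - 3))"
    "overlap_den q x (0) (2) = 2 * ((x\<^sup>2 - 4) * (x\<^sup>2 + 2 * x - 2))"
    "overlap_den q x (- 1) (q) = 2 * ((x\<^sup>2 - 3) * (x\<^sup>2 + 2 * x))"
    "overlap_den q x (- q) (1) = 2 * ((x\<^sup>2 - 1) * (x\<^sup>2 + 2 * x + 1))"
    by (simp_all add: overlap_den_def power2_eq_square power3_eq_cube algebra_simps qq)
qed

text \<open>The numerators are odd and the denominator is even in the pair \<open>(d, s)\<close>;
  after squaring, only the residue class remains.\<close>

lemma overlap_num_sign: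
  fixes e :: real
  assumes "e\<^sup>2 = 1"
  shows "(overlap_3_num q x (e * d) (e * s))\<^sup>2 = (overlap_3_num q x d s)\<^sup>2"
    and "(overlap_4_num q x (e * d) (e * s))\<^sup>2 = (overlap_4_num q x d s)\<^sup>2"
    and "overlap_den q x (e * d) (e * s) = overlap_den q x d s"
proof -
  consider "e = 1" | "e = - 1" using assms power2_eq_1_iff by blast
  then have *: "overlap_3_num q x (e * d) (e * s) = e * overlap_3_num q x d s \<and>
      overlap_4_num q x (e * d) (e * s) = e * overlap_4_num q x d s \<and>
      overlap_den q x (e * d) (e * s) = overlap_den q x d s"
    by cases (simp_all add: overlap_3_num_def overlap_4_num_def overlap_den_def algebra_simps power2_eq_square)
  show "(overlap_3_num q x (e * d) (e * s))\<^sup>2 = (overlap_3_num q x d s)\<^sup>2"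
    "(overlap_4_num q x (e * d) (e * s))\<^sup>2 = (overlap_4_num q x d s)\<^sup>2"
    "overlap_den q x (e * d) (e * s) = overlap_den q x d s"
    using * assms by (simp_all add: power_mult_distrib)
qed

lemma overlap_3_square:
  assumes "m \<ge> 3"
  shows "m mod 6 = 0 \<Longrightarrow> (sixth.overlap 3 m)\<^sup>2 = 3 * (- 2 * (real m)\<^sup>2)\<^sup>2 / (((real m)\<^sup>2) * ((real m)\<^sup>2 + 2 * (real m)))\<^sup>2"
    "m mod 6 = 1 \<Longrightarrow> (sixth.overlap 3 m)\<^sup>2 = (8 * (real m) - 2 * (real m)\<^sup>2 - (real m)^3 - 6)\<^sup>2 / (((real m)\<^sup>2 - 1) * ((real m)\<^sup>2 + 2 * (real m) - 2))\<^sup>2"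
    "m mod 6 = 2 \<Longrightarrow> (sixth.overlap 3 m)\<^sup>2 = 3 * (7 * (real m) - (real m)^3 - 6)\<^sup>2 / (((real m)\<^sup>2 - 3) * ((real m)\<^sup>2 + 2 * (real m) - 3))\<^sup>2"
    "m mod 6 = 3 \<Longrightarrow> (sixth.overlap 3 m)\<^sup>2 = (16 * (real m) + 2 * (real m)\<^sup>2 - 2 * (real m)^3)\<^sup>2 / (((real m)\<^sup>2 - 4) * ((real m)\<^sup>2 + 2 * (real m) - 2))\<^sup>2"
    "m mod 6 = 4 \<Longrightarrow> (sixth.overlap 3 m)\<^sup>2 = 3 * (6 + 10 * (real m) + 2 * (real m)\<^sup>2 - (real m)^3)\<^sup>2 / (((real m)\<^sup>2 - 3) * ((real m)\<^sup>2 + 2 * (real m)))\<^sup>2"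
    "m mod 6 = 5 \<Longrightarrow> (sixth.overlap 3 m)\<^sup>2 = (6 + 11 * (real m) + 4 * (real m)\<^sup>2 - (real m)^3)\<^sup>2 / (((real m)\<^sup>2 - 1) * ((real m)\<^sup>2 + 2 * (real m) + 1))\<^sup>2"
proof -
  obtain e :: real where e: "e\<^sup>2 = 1"
    "cos (real m * (pi / 6)) = e * cos (real (m mod 6) * (pi / 6))"
    "sin (real m * (pi / 6)) = e * sin (real (m mod 6) * (pi / 6))"
    by (rule pi_sixth_angle)
  have q: "(sqrt 3)\<^sup>2 = (3 :: real)" by simp
  have closed: "(sixth.overlap 3 m)\<^sup>2 = A\<^sup>2 / B\<^sup>2"
    if "m mod 6 = r" "2 * cos (real r * (pi / 6)) = d" "2 * sin (real r * (pi / 6)) = s"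
      "overlap_3_num (sqrt 3) (real m) d s = 2 * A"
      "overlap_den (sqrt 3) (real m) d s = 2 * B" for r d s A B
  proof -
    have "2 * cos (real m * (pi / 6)) = e * d" "2 * sin (real m * (pi / 6)) = e * s"
      unfolding e(2,3) using that(1-3) by simp_all
    then have "(sixth.overlap 3 m)\<^sup>2 = (overlap_3_num (sqrt 3) (real m) d s)\<^sup>2 / (overlap_den (sqrt 3) (real m) d s)\<^sup>2"
      by (simp only: overlap_3_closed_form[OF assms] power_divide overlap_num_sign[OF e(1)])
    then show ?thesis unfolding that(4,5) by (simp add: power_mult_distrib)
  qed
  show "(sixth.overlap 3 m)\<^sup>2 = 3 * (- 2 * (real m)\<^sup>2)\<^sup>2 / (((real m)\<^sup>2) * ((real m)\<^sup>2 + 2 * (real m)))\<^sup>2" if "m mod 6 = 0"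
    using closed[OF that pi_sixth_values(1,2) overlap_3_num_values(1)[OF q] overlap_den_values(1)[OF q]]
    by (simp only: power_mult_distrib[of "sqrt 3"] q)
  show "(sixth.overlap 3 m)\<^sup>2 = (8 * (real m) - 2 * (real m)\<^sup>2 - (real m)^3 - 6)\<^sup>2 / (((real m)\<^sup>2 - 1) * ((real m)\<^sup>2 + 2 * (real m) - 2))\<^sup>2" if "m mod 6 = 1"
    using closed[OF that pi_sixth_values(3,4) overlap_3_num_values(2)[OF q] overlap_den_values(2)[OF q]]
    by (simp only: power_mult_distrib[of "sqrt 3"] q)
  show "(sixth.overlap 3 m)\<^sup>2 = 3 * (7 * (real m) - (real m)^3 - 6)\<^sup>2 / (((real m)\<^sup>2 - 3) * ((real m)\<^sup>2 + 2 * (real m) - 3))\<^sup>2" if "m mod 6 = 2"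
    using closed[OF that pi_sixth_values(5,6) overlap_3_num_values(3)[OF q] overlap_den_values(3)[OF q]]
    by (simp only: power_mult_distrib[of "sqrt 3"] q)
  show "(sixth.overlap 3 m)\<^sup>2 = (16 * (real m) + 2 * (real m)\<^sup>2 - 2 * (real m)^3)\<^sup>2 / (((real m)\<^sup>2 - 4) * ((real m)\<^sup>2 + 2 * (real m) - 2))\<^sup>2" if "m mod 6 = 3"
    using closed[OF that pi_sixth_values(7,8) overlap_3_num_values(4)[OF q] overlap_den_values(4)[OF q]]
    by (simp only: power_mult_distrib[of "sqrt 3"] q)
  show "(sixth.overlap 3 m)\<^sup>2 = 3 * (6 + 10 * (real m) + 2 * (real m)\<^sup>2 - (real m)^3)\<^sup>2 / (((real m)\<^sup>2 - 3) * ((real m)\<^sup>2 + 2 * (real m)))\<^sup>2" if "m mod 6 = 4"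
    using closed[OF that pi_sixth_values(9,10) overlap_3_num_values(5)[OF q] overlap_den_values(5)[OF q]]
    by (simp only: power_mult_distrib[of "sqrt 3"] q)
  show "(sixth.overlap 3 m)\<^sup>2 = (6 + 11 * (real m) + 4 * (real m)\<^sup>2 - (real m)^3)\<^sup>2 / (((real m)\<^sup>2 - 1) * ((real m)\<^sup>2 + 2 * (real m) + 1))\<^sup>2" if "m mod 6 = 5"
    using closed[OF that pi_sixth_values(11,12) overlap_3_num_values(6)[OF q] overlap_den_values(6)[OF q]]
    by (simp only: power_mult_distrib[of "sqrt 3"] q)
qed

lemma overlap_4_square:
  assumes "m \<ge> 4"
  shows "m mod 6 = 0 \<Longrightarrow> (sixth.overlap 4 m)\<^sup>2 = (- (real m)\<^sup>2 - (real m)^3)\<^sup>2 / (((real m)\<^sup>2) * ((real m)\<^sup>2 + 2 * (real m)))\<^sup>2"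
    "m mod 6 = 1 \<Longrightarrow> (sixth.overlap 4 m)\<^sup>2 = 3 * (3 * (real m) + (real m)\<^sup>2 - (real m)^3 - 5)\<^sup>2 / (((real m)\<^sup>2 - 1) * ((real m)\<^sup>2 + 2 * (real m) - 2))\<^sup>2"
    "m mod 6 = 2 \<Longrightarrow> (sixth.overlap 4 m)\<^sup>2 = (6 * (real m) + 4 * (real m)\<^sup>2 - 2 * (real m)^3 - 24)\<^sup>2 / (((real m)\<^sup>2 - 3) * ((real m)\<^sup>2 + 2 * (real m) - 3))\<^sup>2"
    "m mod 6 = 3 \<Longrightarrow> (sixth.overlap 4 m)\<^sup>2 = 3 * (4 * (real m) + 3 * (real m)\<^sup>2 - (real m)^3 - 12)\<^sup>2 / (((real m)\<^sup>2 - 4) * ((real m)\<^sup>2 + 2 * (real m) - 2))\<^sup>2"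
    "m mod 6 = 4 \<Longrightarrow> (sixth.overlap 4 m)\<^sup>2 = (9 * (real m) + 5 * (real m)\<^sup>2 - (real m)^3 - 3)\<^sup>2 / (((real m)\<^sup>2 - 3) * ((real m)\<^sup>2 + 2 * (real m)))\<^sup>2"
    "m mod 6 = 5 \<Longrightarrow> (sixth.overlap 4 m)\<^sup>2 = 3 * (2 + 4 * (real m) + 2 * (real m)\<^sup>2)\<^sup>2 / (((real m)\<^sup>2 - 1) * ((real m)\<^sup>2 + 2 * (real m) + 1))\<^sup>2"
proof -
  obtain e :: real where e: "e\<^sup>2 = 1"
    "cos (real m * (pi / 6)) = e * cos (real (m mod 6) * (pi / 6))"
    "sin (real m * (pi / 6)) = e * sin (real (m mod 6) * (pi / 6))"
    by (rule pi_sixth_angle)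
  have q: "(sqrt 3)\<^sup>2 = (3 :: real)" by simp
  have closed: "(sixth.overlap 4 m)\<^sup>2 = A\<^sup>2 / B\<^sup>2"
    if "m mod 6 = r" "2 * cos (real r * (pi / 6)) = d" "2 * sin (real r * (pi / 6)) = s"
      "overlap_4_num (sqrt 3) (real m) d s = 2 * A"
      "overlap_den (sqrt 3) (real m) d s = 2 * B" for r d s A B
  proof -
    have "2 * cos (real m * (pi / 6)) = e * d" "2 * sin (real m * (pi / 6)) = e * s"
      unfolding e(2,3) using that(1-3) by simp_all
    then have "(sixth.overlap 4 m)\<^sup>2 = (overlap_4_num (sqrt 3) (real m) d s)\<^sup>2 / (overlap_den (sqrt 3) (real m) d s)\<^sup>2"
      by (simp only: overlap_4_closed_form[OF assms] power_divide overlap_num_sign[OF e(1)])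
    then show ?thesis unfolding that(4,5) by (simp add: power_mult_distrib)
  qed
  show "(sixth.overlap 4 m)\<^sup>2 = (- (real m)\<^sup>2 - (real m)^3)\<^sup>2 / (((real m)\<^sup>2) * ((real m)\<^sup>2 + 2 * (real m)))\<^sup>2" if "m mod 6 = 0"
    using closed[OF that pi_sixth_values(1,2) overlap_4_num_values(1)[OF q] overlap_den_values(1)[OF q]]
    by (simp only: power_mult_distrib[of "sqrt 3"] q)
  show "(sixth.overlap 4 m)\<^sup>2 = 3 * (3 * (real m) + (real m)\<^sup>2 - (real m)^3 - 5)\<^sup>2 / (((real m)\<^sup>2 - 1) * ((real m)\<^sup>2 + 2 * (real m) - 2))\<^sup>2" if "m mod 6 = 1"
    using closed[OF that pi_sixth_values(3,4) overlap_4_num_values(2)[OF q] overlap_den_values(2)[OF q]]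
    by (simp only: power_mult_distrib[of "sqrt 3"] q)
  show "(sixth.overlap 4 m)\<^sup>2 = (6 * (real m) + 4 * (real m)\<^sup>2 - 2 * (real m)^3 - 24)\<^sup>2 / (((real m)\<^sup>2 - 3) * ((real m)\<^sup>2 + 2 * (real m) - 3))\<^sup>2" if "m mod 6 = 2"
    using closed[OF that pi_sixth_values(5,6) overlap_4_num_values(3)[OF q] overlap_den_values(3)[OF q]]
    by (simp only: power_mult_distrib[of "sqrt 3"] q)
  show "(sixth.overlap 4 m)\<^sup>2 = 3 * (4 * (real m) + 3 * (real m)\<^sup>2 - (real m)^3 - 12)\<^sup>2 / (((real m)\<^sup>2 - 4) * ((real m)\<^sup>2 + 2 * (real m) - 2))\<^sup>2" if "m mod 6 = 3"
    using closed[OF that pi_sixth_values(7,8) overlap_4_num_values(4)[OF q] overlap_den_values(4)[OF q]]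
    by (simp only: power_mult_distrib[of "sqrt 3"] q)
  show "(sixth.overlap 4 m)\<^sup>2 = (9 * (real m) + 5 * (real m)\<^sup>2 - (real m)^3 - 3)\<^sup>2 / (((real m)\<^sup>2 - 3) * ((real m)\<^sup>2 + 2 * (real m)))\<^sup>2" if "m mod 6 = 4"
    using closed[OF that pi_sixth_values(9,10) overlap_4_num_values(5)[OF q] overlap_den_values(5)[OF q]]
    by (simp only: power_mult_distrib[of "sqrt 3"] q)
  show "(sixth.overlap 4 m)\<^sup>2 = 3 * (2 + 4 * (real m) + 2 * (real m)\<^sup>2)\<^sup>2 / (((real m)\<^sup>2 - 1) * ((real m)\<^sup>2 + 2 * (real m) + 1))\<^sup>2" if "m mod 6 = 5"
    using closed[OF that pi_sixth_values(11,12) overlap_4_num_values(6)[OF q] overlap_den_values(6)[OF q]]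
    by (simp only: power_mult_distrib[of "sqrt 3"] q)
qed

subsection \<open>Numerical bounds\<close>

text \<open>The summands \<open>\<bar>overlap 4 m\<bar>\<^sup>2 - \<bar>overlap 3 m\<bar>\<^sup>2\<close> behave like \<open>a\<^sub>r / m\<^sup>2 + b\<^sub>r / m\<^sup>3\<close> with \<open>r = m mod 6\<close> and
  \<open>a = (1, 2, 1, -1, -2, -1)\<close>, \<open>b = (-2, -18, -20, -6, 10, 12)\<close>.  Both periods are compatible with a
  telescoping minorant: \<open>tail_bound m - tail_bound (m + 1)\<close> has these coefficients, and the free constant in
  the numerator is lowered until the minorant is valid in all residue classes.\<close>

definition tail_bound :: "nat \<Rightarrow> real" where
  "tail_bound m =
     ([0, - 1, - 3, - 4, - 3, - 1] ! (m mod 6) * real m + [- 12, - 12, 0, 12, 12, 0] ! (m mod 6)) / real m ^ 3"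

text \<open>With denominators cleared, this compares the telescoping minorant with the summand for
  \<open>m mod 6 = 0\<close>; the next five treat the other classes. Both sides have degree 12, and
  matching the 1/x^2 and 1/x^3 coefficients leaves a difference of degree 10. Expanded around
  \<open>x = 6\<close> it has only positive coefficients, which certifies the inequality.\<close>

lemma tail_poly_0:
  fixes x :: real
  assumes "x \<ge> 6"
  shows "((0 * x + -12) * (x + 1) ^ 3 - (-1 * (x + 1) + -12) * x ^ 3) * ((x\<^sup>2) * (x\<^sup>2 + 2 * x))\<^sup>2
      \<le> ((- x\<^sup>2 - x^3)\<^sup>2 - 3 * (- 2 * x\<^sup>2)\<^sup>2) * (x ^ 3 * (x + 1) ^ 3)"
proof -
  define y where "y = x - 6"
  have x: "x = y + 6" and y: "y \<ge> 0" using assms by (simp_all add: y_def)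
  have "((- x\<^sup>2 - x^3)\<^sup>2 - 3 * (- 2 * x\<^sup>2)\<^sup>2) * (x ^ 3 * (x + 1) ^ 3)
      - ((0 * x + -12) * (x + 1) ^ 3 - (-1 * (x + 1) + -12) * x ^ 3) * ((x\<^sup>2) * (x\<^sup>2 + 2 * x))\<^sup>2 =
     3588499584 + y * (5551457472 + y * (3858707808 + y * (1586821104 + y * (427506120 + y * (78835140 + y * (10076562 + y * (881413 + y * (50489 + y * (1710 + y * (26))))))))))"
    unfolding x by (simp add: algebra_simps power2_eq_square power3_eq_cube)
  also have "\<dots> \<ge> 0" using y by (intro add_nonneg_nonneg mult_nonneg_nonneg) auto
  finally show ?thesis by simp
qed

lemma tail_poly_1:
  fixes x :: real
  assumes "x \<ge> 6"
  shows "((-1 * x + -12) * (x + 1) ^ 3 - (-3 * (x + 1) + 0) * x ^ 3) * ((x\<^sup>2 - 1) * (x\<^sup>2 + 2 * x - 2))\<^sup>2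
      \<le> (3 * (3 * x + x\<^sup>2 - x^3 - 5)\<^sup>2 - (8 * x - 2 * x\<^sup>2 - x^3 - 6)\<^sup>2) * (x ^ 3 * (x + 1) ^ 3)"
proof -
  define y where "y = x - 6"
  have x: "x = y + 6" and y: "y \<ge> 0" using assms by (simp_all add: y_def)
  have "(3 * (3 * x + x\<^sup>2 - x^3 - 5)\<^sup>2 - (8 * x - 2 * x\<^sup>2 - x^3 - 6)\<^sup>2) * (x ^ 3 * (x + 1) ^ 3)
      - ((-1 * x + -12) * (x + 1) ^ 3 - (-3 * (x + 1) + 0) * x ^ 3) * ((x\<^sup>2 - 1) * (x\<^sup>2 + 2 * x - 2))\<^sup>2 =
     5961071088 + y * (9661806280 + y * (7023311386 + y * (3015173239 + y * (846597789 + y * (162444797 + y * (21571895 + y * (1957608 + y * (116182 + y * (4072 + y * (64))))))))))"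
    unfolding x by (simp add: algebra_simps power2_eq_square power3_eq_cube)
  also have "\<dots> \<ge> 0" using y by (intro add_nonneg_nonneg mult_nonneg_nonneg) auto
  finally show ?thesis by simp
qed

lemma tail_poly_2:
  fixes x :: real
  assumes "x \<ge> 6"
  shows "((-3 * x + 0) * (x + 1) ^ 3 - (-4 * (x + 1) + 12) * x ^ 3) * ((x\<^sup>2 - 3) * (x\<^sup>2 + 2 * x - 3))\<^sup>2
      \<le> ((6 * x + 4 * x\<^sup>2 - 2 * x^3 - 24)\<^sup>2 - 3 * (7 * x - x^3 - 6)\<^sup>2) * (x ^ 3 * (x + 1) ^ 3)"
proof -
  define y where "y = x - 6"
  have x: "x = y + 6" and y: "y \<ge> 0" using assms by (simp_all add: y_def)
  have "((6 * x + 4 * x\<^sup>2 - 2 * x^3 - 24)\<^sup>2 - 3 * (7 * x - x^3 - 6)\<^sup>2) * (x ^ 3 * (x + 1) ^ 3)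
      - ((-3 * x + 0) * (x + 1) ^ 3 - (-4 * (x + 1) + 12) * x ^ 3) * ((x\<^sup>2 - 3) * (x\<^sup>2 + 2 * x - 3))\<^sup>2 =
     4436175438 + y * (7574222763 + y * (5790240207 + y * (2609662113 + y * (767870469 + y * (154122555 + y * (21370011 + y * (2021179 + y * (124793 + y * (4542 + y * (74))))))))))"
    unfolding x by (simp add: algebra_simps power2_eq_square power3_eq_cube)
  also have "\<dots> \<ge> 0" using y by (intro add_nonneg_nonneg mult_nonneg_nonneg) auto
  finally show ?thesis by simp
qed

lemma tail_poly_3:
  fixes x :: real
  assumes "x \<ge> 6"
  shows "((-4 * x + 12) * (x + 1) ^ 3 - (-3 * (x + 1) + 12) * x ^ 3) * ((x\<^sup>2 - 4) * (x\<^sup>2 + 2 * x - 2))\<^sup>2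
      \<le> (3 * (4 * x + 3 * x\<^sup>2 - x^3 - 12)\<^sup>2 - (16 * x + 2 * x\<^sup>2 - 2 * x^3)\<^sup>2) * (x ^ 3 * (x + 1) ^ 3)"
proof -
  define y where "y = x - 6"
  have x: "x = y + 6" and y: "y \<ge> 0" using assms by (simp_all add: y_def)
  have "(3 * (4 * x + 3 * x\<^sup>2 - x^3 - 12)\<^sup>2 - (16 * x + 2 * x\<^sup>2 - 2 * x^3)\<^sup>2) * (x ^ 3 * (x + 1) ^ 3)
      - ((-4 * x + 12) * (x + 1) ^ 3 - (-3 * (x + 1) + 12) * x ^ 3) * ((x\<^sup>2 - 4) * (x\<^sup>2 + 2 * x - 2))\<^sup>2 =
     1591002624 + y * (2803507456 + y * (2201690368 + y * (1016944960 + y * (306337800 + y * (62930084 + y * (8931398 + y * (864843 + y * (54679 + y * (2038 + y * (34))))))))))"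
    unfolding x by (simp add: algebra_simps power2_eq_square power3_eq_cube)
  also have "\<dots> \<ge> 0" using y by (intro add_nonneg_nonneg mult_nonneg_nonneg) auto
  finally show ?thesis by simp
qed

lemma tail_poly_4:
  fixes x :: real
  assumes "x \<ge> 6"
  shows "((-3 * x + 12) * (x + 1) ^ 3 - (-1 * (x + 1) + 0) * x ^ 3) * ((x\<^sup>2 - 3) * (x\<^sup>2 + 2 * x))\<^sup>2
      \<le> ((9 * x + 5 * x\<^sup>2 - x^3 - 3)\<^sup>2 - 3 * (6 + 10 * x + 2 * x\<^sup>2 - x^3)\<^sup>2) * (x ^ 3 * (x + 1) ^ 3)"
proof -
  define y where "y = x - 6"
  have x: "x = y + 6" and y: "y \<ge> 0" using assms by (simp_all add: y_def)
  have "((9 * x + 5 * x\<^sup>2 - x^3 - 3)\<^sup>2 - 3 * (6 + 10 * x + 2 * x\<^sup>2 - x^3)\<^sup>2) * (x ^ 3 * (x + 1) ^ 3)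
      - ((-3 * x + 12) * (x + 1) ^ 3 - (-1 * (x + 1) + 0) * x ^ 3) * ((x\<^sup>2 - 3) * (x\<^sup>2 + 2 * x))\<^sup>2 =
     34360200 + y * (258777180 + y * (311899626 + y * (178974585 + y * (61124859 + y * (13546515 + y * (2012505 + y * (200056 + y * (12818 + y * (480 + y * (8))))))))))"
    unfolding x by (simp add: algebra_simps power2_eq_square power3_eq_cube)
  also have "\<dots> \<ge> 0" using y by (intro add_nonneg_nonneg mult_nonneg_nonneg) auto
  finally show ?thesis by simp
qed

lemma tail_poly_5:
  fixes x :: real
  assumes "x \<ge> 6"
  shows "((-1 * x + 0) * (x + 1) ^ 3 - (0 * (x + 1) + -12) * x ^ 3) * ((x\<^sup>2 - 1) * (x\<^sup>2 + 2 * x + 1))\<^sup>2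
      \<le> (3 * (2 + 4 * x + 2 * x\<^sup>2)\<^sup>2 - (6 + 11 * x + 4 * x\<^sup>2 - x^3)\<^sup>2) * (x ^ 3 * (x + 1) ^ 3)"
proof -
  define y where "y = x - 6"
  have x: "x = y + 6" and y: "y \<ge> 0" using assms by (simp_all add: y_def)
  have "(3 * (2 + 4 * x + 2 * x\<^sup>2)\<^sup>2 - (6 + 11 * x + 4 * x\<^sup>2 - x^3)\<^sup>2) * (x ^ 3 * (x + 1) ^ 3)
      - ((-1 * x + 0) * (x + 1) ^ 3 - (0 * (x + 1) + -12) * x ^ 3) * ((x\<^sup>2 - 1) * (x\<^sup>2 + 2 * x + 1))\<^sup>2 =
     564009306 + y * (1018621849 + y * (805153741 + y * (369427807 + y * (109470459 + y * (21960533 + y * (3027317 + y * (283653 + y * (17311 + y * (622 + y * (10))))))))))"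
    unfolding x by (simp add: algebra_simps power2_eq_square power3_eq_cube)
  also have "\<dots> \<ge> 0" using y by (intro add_nonneg_nonneg mult_nonneg_nonneg) auto
  finally show ?thesis by simp
qed

section \<open>Lower bound for the partial sums of the difference\<close>

definition overlap_diff :: "nat \<Rightarrow> real" where
  "overlap_diff m = (sixth.overlap 4 m)\<^sup>2 - (sixth.overlap 3 m)\<^sup>2"

lemma frac_diff_le:
  fixes A B P Q D x :: real
  assumes "(A * (x + 1) ^ 3 - B * x ^ 3) * D\<^sup>2 \<le> (P - Q) * (x ^ 3 * (x + 1) ^ 3)" "D \<noteq> 0" "x > 0"
  shows "A / x ^ 3 - B / (x + 1) ^ 3 \<le> P / D\<^sup>2 - Q / D\<^sup>2"
proof -
  have "A / x ^ 3 - B / (x + 1) ^ 3 = (A * (x + 1) ^ 3 - B * x ^ 3) / (x ^ 3 * (x + 1) ^ 3)"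
    using assms(3) by (simp add: divide_simps)
  also have "\<dots> = (A * (x + 1) ^ 3 - B * x ^ 3) * D\<^sup>2 / (x ^ 3 * (x + 1) ^ 3 * D\<^sup>2)"
    using assms(2) by simp
  also have "\<dots> \<le> (P - Q) * (x ^ 3 * (x + 1) ^ 3) / (x ^ 3 * (x + 1) ^ 3 * D\<^sup>2)"
    using assms(1,3) by (intro divide_right_mono) auto
  also have "\<dots> = (P - Q) / D\<^sup>2"
    using assms(3) by simp
  finally show ?thesis by (simp add: diff_divide_distrib)
qed

lemma overlap_diff_ge:
  assumes "m \<ge> 6"
  shows "tail_bound m - tail_bound (m + 1) \<le> overlap_diff m"
proof -
  define x where "x = real m"
  have x: "x \<ge> 6" using assms by (simp add: x_def)
  have sq: "x\<^sup>2 \<ge> 36" using power_mono[OF x, of 2] by simp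
  have m: "m \<ge> 3" "m \<ge> 4" using assms by simp_all
  have suc: "real (m + 1) = x + 1" by (simp add: x_def)
  note square = overlap_3_square[OF m(1)] overlap_4_square[OF m(2)]
  consider "m mod 6 = 0" | "m mod 6 = 1" | "m mod 6 = 2" | "m mod 6 = 3" | "m mod 6 = 4" | "m mod 6 = 5"
    by linarith
  then show ?thesis
  proof cases
    case 1
    then have "(m + 1) mod 6 = 1" by presburger
    moreover have "(x\<^sup>2) * (x\<^sup>2 + 2 * x) \<noteq> 0" using x sq by simp
    ultimately show ?thesis
      using frac_diff_le[OF tail_poly_0[OF x]] x 1
      unfolding tail_bound_def overlap_diff_def overlap_3_square(1)[OF m(1) 1] overlap_4_square(1)[OF m(2) 1] suc x_def[symmetric]
      by simp
  next
    case 2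
    then have "(m + 1) mod 6 = 2" by presburger
    moreover have "(x\<^sup>2 - 1) * (x\<^sup>2 + 2 * x - 2) \<noteq> 0" using x sq by simp
    ultimately show ?thesis
      using frac_diff_le[OF tail_poly_1[OF x]] x 2
      unfolding tail_bound_def overlap_diff_def overlap_3_square(2)[OF m(1) 2] overlap_4_square(2)[OF m(2) 2] suc x_def[symmetric]
      by simp
  next
    case 3
    then have "(m + 1) mod 6 = 3" by presburger
    moreover have "(x\<^sup>2 - 3) * (x\<^sup>2 + 2 * x - 3) \<noteq> 0" using x sq by simp
    ultimately show ?thesis
      using frac_diff_le[OF tail_poly_2[OF x]] x 3
      unfolding tail_bound_def overlap_diff_def overlap_3_square(3)[OF m(1) 3] overlap_4_square(3)[OF m(2) 3] suc x_def[symmetric]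
      by simp
  next
    case 4
    then have "(m + 1) mod 6 = 4" by presburger
    moreover have "(x\<^sup>2 - 4) * (x\<^sup>2 + 2 * x - 2) \<noteq> 0" using x sq by simp
    ultimately show ?thesis
      using frac_diff_le[OF tail_poly_3[OF x]] x 4
      unfolding tail_bound_def overlap_diff_def overlap_3_square(4)[OF m(1) 4] overlap_4_square(4)[OF m(2) 4] suc x_def[symmetric]
      by simp
  next
    case 5
    then have "(m + 1) mod 6 = 5" by presburger
    moreover have "(x\<^sup>2 - 3) * (x\<^sup>2 + 2 * x) \<noteq> 0" using x sq by simp
    ultimately show ?thesis
      using frac_diff_le[OF tail_poly_4[OF x]] x 5
      unfolding tail_bound_def overlap_diff_def overlap_3_square(5)[OF m(1) 5] overlap_4_square(5)[OF m(2) 5] suc x_def[symmetric]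
      by simp
  next
    case 6
    then have "(m + 1) mod 6 = 0" by presburger
    moreover have "(x\<^sup>2 - 1) * (x\<^sup>2 + 2 * x + 1) \<noteq> 0" using x sq by simp
    ultimately show ?thesis
      using frac_diff_le[OF tail_poly_5[OF x]] x 6
      unfolding tail_bound_def overlap_diff_def overlap_3_square(6)[OF m(1) 6] overlap_4_square(6)[OF m(2) 6] suc x_def[symmetric]
      by simp
  qed
qed

lemma sum_overlap_diff_ge:
  assumes "6 \<le> k" "k \<le> n"
  shows "tail_bound k - tail_bound n \<le> (\<Sum>m = k..<n. overlap_diff m)"
  using assms(2)
proof (induction n rule: dec_induct)
  case (step n)
  then show ?case using overlap_diff_ge[of n] assms(1) by simp
qed simp

text \<open>Lets the far end of the telescoping sum be discarded, so the lower bound is uniform in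
  the length of the partial sum. The restriction comes from the class \<open>m mod 6 = 4\<close>,
  where the numerator is \<open>- 3 m + 12\<close>.\<close>

lemma tail_bound_nonpos: "tail_bound m \<le> 0" if "m \<ge> 4"
proof -
  consider "m mod 6 = 0" | "m mod 6 = 1" | "m mod 6 = 2" | "m mod 6 = 3" | "m mod 6 = 4" | "m mod 6 = 5"
    by linarith
  then show ?thesis
    using that by cases (auto simp: tail_bound_def intro!: divide_nonpos_nonneg)
qed

lemma sixth_overlap_eq_0: "m < k \<Longrightarrow> sixth.overlap k m = 0"
  by (simp add: sixth.overlap_def)

text \<open>The constants are the exact rational values rounded down to seven decimals. The cut is
  at 18 because stopping at 17 would, after subtracting the tail loss 17 / 17^3, leave only about
  1.6 / 10^4, short of 13/75000.\<close>

lemma overlap_diff_initial: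
  "(\<Sum>m = 2..<18. overlap_diff m) \<ge> 23063 / 10 ^ 7"
proof -
  have d2: "overlap_diff 2 \<ge> 0 / 10 ^ 7"
    by (simp add: overlap_diff_def sixth_overlap_eq_0[of 2 4] sixth_overlap_eq_0[of 2 3])
  have d3: "overlap_diff 3 \<ge> -340829 / 10 ^ 7"
    by (simp add: overlap_diff_def sixth_overlap_eq_0[of 3 4] overlap_3_square(4))
  have d4: "overlap_diff 4 \<ge> 186246 / 10 ^ 7"
    by (simp add: overlap_diff_def overlap_3_square(5) overlap_4_square(5))
  have d5: "overlap_diff 5 \<ge> 190972 / 10 ^ 7"
    by (simp add: overlap_diff_def overlap_3_square(6) overlap_4_square(6))
  have d6: "overlap_diff 6 \<ge> 160590 / 10 ^ 7"
    by (simp add: overlap_diff_def overlap_3_square(1) overlap_4_square(1))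
  have d7: "overlap_diff 7 \<ge> 92113 / 10 ^ 7"
    by (simp add: overlap_diff_def overlap_3_square(2) overlap_4_square(2))
  have d8: "overlap_diff 8 \<ge> -39343 / 10 ^ 7"
    by (simp add: overlap_diff_def overlap_3_square(3) overlap_4_square(3))
  have d9: "overlap_diff 9 \<ge> -123109 / 10 ^ 7"
    by (simp add: overlap_diff_def overlap_3_square(4) overlap_4_square(4))
  have d10: "overlap_diff 10 \<ge> -94055 / 10 ^ 7"
    by (simp add: overlap_diff_def overlap_3_square(5) overlap_4_square(5))
  have d11: "overlap_diff 11 \<ge> -9028 / 10 ^ 7"
    by (simp add: overlap_diff_def overlap_3_square(6) overlap_4_square(6))
  have d12: "overlap_diff 12 \<ge> 55626 / 10 ^ 7"
    by (simp add: overlap_diff_def overlap_3_square(1) overlap_4_square(1))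
  have d13: "overlap_diff 13 \<ge> 56968 / 10 ^ 7"
    by (simp add: overlap_diff_def overlap_3_square(2) overlap_4_square(2))
  have d14: "overlap_diff 14 \<ge> 2569 / 10 ^ 7"
    by (simp add: overlap_diff_def overlap_3_square(3) overlap_4_square(3))
  have d15: "overlap_diff 15 \<ge> -49978 / 10 ^ 7"
    by (simp add: overlap_diff_def overlap_3_square(4) overlap_4_square(4))
  have d16: "overlap_diff 16 \<ge> -52537 / 10 ^ 7"
    by (simp add: overlap_diff_def overlap_3_square(5) overlap_4_square(5))
  have d17: "overlap_diff 17 \<ge> -13142 / 10 ^ 7"
    by (simp add: overlap_diff_def overlap_3_square(6) overlap_4_square(6))
  have "{2..<18::nat} = {2, 3, 4, 5, 6, 7, 8, 9, 10, 11, 12, 13, 14, 15, 16, 17}" by auto presburger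
  then have "(\<Sum>m = 2..<18. overlap_diff m) = overlap_diff 2 + overlap_diff 3 + overlap_diff 4 + overlap_diff 5 + overlap_diff 6 + overlap_diff 7 + overlap_diff 8 + overlap_diff 9 + overlap_diff 10 + overlap_diff 11 + overlap_diff 12 + overlap_diff 13 + overlap_diff 14 + overlap_diff 15 + overlap_diff 16 + overlap_diff 17"
    by simp
  then show ?thesis using d2 d3 d4 d5 d6 d7 d8 d9 d10 d11 d12 d13 d14 d15 d16 d17 by simp
qed

text \<open>The initial block gives about 23.06 / 10^4 and the tail costs at most 12 / 18^3, about
  20.58 / 10^4. The bound 2 / 10^4 lies strictly above 13/75000, so the weak inequality that
  survives the limit still yields a strict one.\<close>

lemma sum_overlap_diff_lower:
  assumes "n \<ge> 18"
  shows "(\<Sum>m = 2..<n. overlap_diff m) \<ge> 2 / 10 ^ 4"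
proof -
  have "(\<Sum>m = 2..<n. overlap_diff m) = (\<Sum>m = 2..<18. overlap_diff m) + (\<Sum>m = 18..<n. overlap_diff m)"
    using assms by (simp add: sum.atLeastLessThan_concat)
  moreover have "tail_bound 18 - tail_bound n \<le> (\<Sum>m = 18..<n. overlap_diff m)"
    by (rule sum_overlap_diff_ge) (use assms in auto)
  moreover have "tail_bound n \<le> 0" by (rule tail_bound_nonpos) (use assms in simp)
  moreover have "tail_bound 18 = - 12 / 18 ^ 3" by (simp add: tail_bound_def)
  ultimately show ?thesis using overlap_diff_initial by simp
qed

section \<open>Summability and passage to the limit\<close>

lemma abs_sixth_overlap_le:
  assumes "n \<ge> 1"
  shows "\<bar>sixth.overlap k (n + 2)\<bar> \<le> 16 / real n"
proof -
  have "\<bar>sixth.sin_quot (n + 2)\<bar> \<le> 2"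
    using abs_sin_le_one[of "real (n + 2) * (pi / 6)"] unfolding sixth_sin_quot abs_mult by simp
  then have "\<bar>sixth.overlap k (n + 2)\<bar> \<le> real (n + 2 + 1) * (2 / (real (n + 2) - 2))\<^sup>2"
    using assms by (intro sixth.abs_overlap_le) auto
  also have "\<dots> = 4 * (real n + 3) / (real n)\<^sup>2" by (simp add: power_divide)
  also have "\<dots> \<le> 16 * real n / (real n)\<^sup>2"
    using assms by (intro divide_right_mono) auto
  also have "\<dots> = 16 / real n" using assms by (simp add: power2_eq_square)
  finally show ?thesis .
qed

lemma summable_sixth_overlap: "summable (\<lambda>n. (sixth.overlap k (n + 2))\<^sup>2)"
proof (rule summable_comparison_test')
  show "summable (\<lambda>n. 256 * (1 / real n ^ 2))"
    using inverse_power_summable[of 2, where 'a = real]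
    by (intro summable_mult) (simp add: inverse_eq_divide)
  fix n :: nat assume n: "n \<ge> 1"
  have "(sixth.overlap k (n + 2))\<^sup>2 \<le> (16 / real n)\<^sup>2"
    using abs_sixth_overlap_le[OF n, of k] by (rule power2_le_iff_abs_le[THEN iffD2, rotated]) simp
  then show "norm ((sixth.overlap k (n + 2))\<^sup>2) \<le> 256 * (1 / real n ^ 2)"
    by (simp add: power_divide)
qed

lemma Sigma_gen_sixth:
  assumes "k \<ge> 1"
  shows "Sigma_gen sixth.arc_form k = ennreal (\<Sum>n. (sixth.overlap k (n + 2))\<^sup>2)"
  unfolding sixth.Sigma_gen_arc_form[OF assms]
  by (rule suminf_ennreal2[OF _ summable_sixth_overlap]) simp

lemma Sigma_gen_sixth_diff:
  "(\<Sum>n. (sixth.overlap 4 (n + 2))\<^sup>2) - (\<Sum>n. (sixth.overlap 3 (n + 2))\<^sup>2) \<ge> 2 / 10 ^ 4"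
proof -
  have sm: "summable (\<lambda>n. overlap_diff (n + 2))"
    unfolding overlap_diff_def by (intro summable_diff summable_sixth_overlap)
  have "2 / 10 ^ 4 \<le> (\<Sum>n. overlap_diff (n + 2))"
  proof (rule LIMSEQ_le_const)
    show "(\<lambda>N. \<Sum>n<N. overlap_diff (n + 2)) \<longlonglongrightarrow> (\<Sum>n. overlap_diff (n + 2))"
      by (rule summable_LIMSEQ[OF sm])
    have "(\<Sum>n<N. overlap_diff (n + 2)) = (\<Sum>m = 2..<N + 2. overlap_diff m)" for N
      using sum.shift_bounds_nat_ivl[of overlap_diff 0 2 N] by (simp add: atLeast0LessThan numeral_2_eq_2)
    moreover have "2 / 10 ^ 4 \<le> (\<Sum>m = 2..<N + 2. overlap_diff m)" if "N \<ge> 16" for N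
      using that by (intro sum_overlap_diff_lower) simp
    ultimately show "\<exists>N. \<forall>n\<ge>N. 2 / 10 ^ 4 \<le> (\<Sum>n<n. overlap_diff (n + 2))"
      by metis
  qed
  also have "\<dots> = (\<Sum>n. (sixth.overlap 4 (n + 2))\<^sup>2) - (\<Sum>n. (sixth.overlap 3 (n + 2))\<^sup>2)"
    unfolding overlap_diff_def by (intro suminf_diff[symmetric] summable_sixth_overlap)
  finally show ?thesis .
qed

subsection \<open>Uniqueness of the homogeneous generator\<close>

lemma finite_expansion_homogeneous_mult:
  assumes "finite_expansion g b"
  shows "finite_expansion (\<lambda>z w. (\<Sum>i\<le>d. c i * z ^ i * w ^ (d - i)) * g z w)
    (\<lambda>(i, j). \<Sum>l\<le>d. c l * (if l \<le> i \<and> d - l \<le> j then b (i - l, j - (d - l)) else 0))"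
proof -
  have "finite_expansion (\<lambda>z w. \<Sum>l\<le>d. c l * (z ^ l * w ^ (d - l) * g z w))
     (\<lambda>ij. \<Sum>l\<le>d. c l * (case ij of (i, j) \<Rightarrow> if l \<le> i \<and> d - l \<le> j then b (i - l, j - (d - l)) else 0))"
    by (intro finite_expansion_sum finite_expansion_cmult finite_expansion_shift assms) auto
  moreover have "(\<lambda>z w. (\<Sum>i\<le>d. c i * z ^ i * w ^ (d - i)) * g z w) =
      (\<lambda>z w. \<Sum>l\<le>d. c l * (z ^ l * w ^ (d - l) * g z w))"
    by (simp add: fun_eq_iff sum_distrib_right mult.assoc)
  ultimately show ?thesis by (simp add: case_prod_unfold)
qed

lemma homogeneous_mem_submodule_gen_self:
  assumes "homogeneous2 d p"
  shows "p \<in> submodule_gen p"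
proof -
  obtain c where "p = (\<lambda>z w. \<Sum>i\<le>d. c i * z ^ i * w ^ (d - i))"
    using assms unfolding homogeneous2_def by blast
  then obtain a where a: "finite_expansion p a" using finite_expansion_homogeneous by blast
  then have "(\<lambda>ij. (norm (a ij))\<^sup>2) summable_on UNIV"
    unfolding finite_expansion_def summable_on_def
    by (auto intro!: has_sum_finite_neutralI[of "{ij. a ij \<noteq> 0}"])
  then have "p \<in> hardy2" using a unfolding finite_expansion_def hardy2_def by blast
  moreover have "\<exists>g\<in>polys2. hardy_norm (\<lambda>z w. p z w - p z w * g z w) < \<epsilon>" if "\<epsilon> > 0" for \<epsilon>
  proof (rule bexI[of _ "\<lambda>_ _. 1"])
    have "hardy_inner (\<lambda>_ _. 0) (\<lambda>_ _. 0) = 0"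
      by (subst hardy_inner_finite_expansion[OF finite_expansion_zero finite_expansion_zero, of "{}"]) auto
    then show "hardy_norm (\<lambda>z w. p z w - p z w * 1) < \<epsilon>" using that by (simp add: hardy_norm_def)
    show "(\<lambda>_ _. 1) \<in> polys2"
      unfolding polys2_def by (intro CollectI exI[of _ 0] exI[of _ "\<lambda>_ _. 1"]) simp
  qed
  ultimately show ?thesis unfolding submodule_gen_def by blast
qed

text \<open>Passing to the closure of \<open>q \<cdot> \<complex>[z,w]\<close> does not affect the components of degree at most \<open>e = deg q\<close>,
  which for a multiple \<open>q g\<close> are \<open>g (0, 0)\<close> times \<open>q\<close> in degree \<open>e\<close> and zero below.\<close>

lemma submodule_gen_lowest_coeff:
  assumes p: "p = (\<lambda>z w. \<Sum>i\<le>d. a i * z ^ i * w ^ (d - i))"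
    and q: "q = (\<lambda>z w. \<Sum>i\<le>e. b i * z ^ i * w ^ (e - i))"
    and "p \<in> submodule_gen q" "\<epsilon> > 0" "d \<le> e"
  obtains s where "\<And>i. i \<le> d \<Longrightarrow> norm (a i - (if d = e then s * b i else 0)) < \<epsilon>"
proof -
  obtain g where g: "g \<in> polys2" "hardy_norm (\<lambda>z w. p z w - q z w * g z w) < \<epsilon>"
    using assms(3,4) unfolding submodule_gen_def by blast
  obtain s where s: "finite_expansion g s" using g(1) by (rule finite_expansion_polys2)
  define h where "h = (\<lambda>(i, j). \<Sum>l\<le>e. b l * (if l \<le> i \<and> e - l \<le> j then s (i - l, j - (e - l)) else 0))"
  have fe: "finite_expansion (\<lambda>z w. p z w - q z w * g z w) (\<lambda>ij. (case ij of (i, j) \<Rightarrow> if i + j = d then a i else 0) - h ij)"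
    unfolding p q h_def
    by (intro finite_expansion_diff finite_expansion_homogeneous finite_expansion_homogeneous_mult s)
  have "norm (a i - (if d = e then s (0, 0) * b i else 0)) < \<epsilon>" if i: "i \<le> d" for i
  proof -
    have "h (i, d - i) = (\<Sum>l\<le>e. if l = i then if d = e then s (0, 0) * b i else 0 else 0)"
      unfolding h_def prod.case
    proof (intro sum.cong refl)
      fix l assume l: "l \<in> {..e}"
      \<comment> \<open>Adding the two inequalities gives \<open>e \<le> d\<close>. Together with
        \<open>d \<le> e\<close> this forces equality in both, so only the constant term of
        \<open>g\<close> contributes.\<close>
      have "l \<le> i \<and> e - l \<le> d - i \<longleftrightarrow> l = i \<and> d = e" using l i assms(5) by auto
      then show "b l * (if l \<le> i \<and> e - l \<le> d - i then s (i - l, d - i - (e - l)) else 0) =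
          (if l = i then if d = e then s (0, 0) * b i else 0 else 0)"
        by (auto simp: mult.commute)
    qed
    also have "\<dots> = (if d = e then s (0, 0) * b i else 0)" using i assms(5) by simp
    finally have "h (i, d - i) = (if d = e then s (0, 0) * b i else 0)" .
    then show ?thesis
      using coeff_le_hardy_norm[OF fe, of "(i, d - i)"] g(2) i by simp
  qed
  then show ?thesis by (rule that)
qed

lemma norm_less_all_imp_eq_0:
  fixes x :: "'a::real_normed_vector"
  assumes "\<And>\<epsilon>. \<epsilon> > 0 \<Longrightarrow> norm x \<le> C * \<epsilon>" "C \<ge> 0"
  shows "x = 0"
proof (rule ccontr)
  assume "x \<noteq> 0"
  then have "norm x / (C + 1) / 2 > 0" using assms(2) by simp
  from assms(1)[OF this] have "norm x \<le> C * (norm x / (C + 1) / 2)" .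
  also have "\<dots> \<le> norm x / 2" using assms(2) by (simp add: divide_simps algebra_simps)
  finally show False using \<open>x \<noteq> 0\<close> by simp
qed

text \<open>Each generator lies in the other's submodule, and a form of degree below that of the
  generator would be approximated by zero, so the degrees agree. In the common degree, the
  coefficients of \<open>p\<close> are arbitrarily close to multiples of those of
  \<open>q\<close>.\<close>

lemma submodule_gen_homogeneous_eq:
  assumes p: "homogeneous2 d p" "p \<noteq> (\<lambda>z w. 0)" and q: "homogeneous2 e q" "q \<noteq> (\<lambda>z w. 0)"
    and eq: "submodule_gen p = submodule_gen q"
  obtains c where "c \<noteq> 0" "p = (\<lambda>z w. c * q z w)"
proof -
  obtain a where a: "p = (\<lambda>z w. \<Sum>i\<le>d. a i * z ^ i * w ^ (d - i))"
    using p(1) unfolding homogeneous2_def by blast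
  obtain b where b: "q = (\<lambda>z w. \<Sum>i\<le>e. b i * z ^ i * w ^ (e - i))"
    using q(1) unfolding homogeneous2_def by blast
  have pq: "p \<in> submodule_gen q" "q \<in> submodule_gen p"
    using homogeneous_mem_submodule_gen_self[OF p(1)] homogeneous_mem_submodule_gen_self[OF q(1)] eq by auto
  have not_less: "\<not> d < e"
    if a: "p = (\<lambda>z w. \<Sum>i\<le>d. a i * z ^ i * w ^ (d - i))"
      and b: "q = (\<lambda>z w. \<Sum>i\<le>e. b i * z ^ i * w ^ (e - i))"
      and "p \<in> submodule_gen q" "p \<noteq> (\<lambda>z w. 0)" for p q :: "complex \<Rightarrow> complex \<Rightarrow> complex" and d e a b
  proof
    assume less: "d < e"
    have "a i = 0" if "i \<le> d" for i
    proof (rule norm_less_all_imp_eq_0)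
      fix \<epsilon> :: real assume "\<epsilon> > 0"
      then obtain s where "\<And>i. i \<le> d \<Longrightarrow> norm (a i - (if d = e then s * b i else 0)) < \<epsilon>"
        using submodule_gen_lowest_coeff[OF a b \<open>p \<in> submodule_gen q\<close>, of \<epsilon>] less by auto
      from this[OF that] show "norm (a i) \<le> 1 * \<epsilon>" using less by simp
    qed simp
    then have "p = (\<lambda>z w. 0)" unfolding a by (simp add: fun_eq_iff)
    with \<open>p \<noteq> _\<close> show False by blast
  qed
  have de: "d = e"
    using not_less[OF a b pq(1) p(2)] not_less[OF b a pq(2) q(2)] by simp
  obtain j where j: "j \<le> e" "b j \<noteq> 0"
    using q(2) unfolding b by (force simp: fun_eq_iff intro!: sum.neutral)
  \<comment> \<open>The approximating factor \<open>s\<close> depends on \<epsilon>. Passing to 2 by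
    2 minors eliminates it, so no convergence of these factors has to be shown.\<close>
  have cross: "a i * b j - b i * a j = 0" if i: "i \<le> e" for i
  proof (rule norm_less_all_imp_eq_0)
    fix \<epsilon> :: real assume "\<epsilon> > 0"
    then obtain s where s: "\<And>i. i \<le> e \<Longrightarrow> norm (a i - s * b i) < \<epsilon>"
      using submodule_gen_lowest_coeff[OF a b pq(1), of \<epsilon>] de by auto
    have "a i * b j - b i * a j = (a i - s * b i) * b j - b i * (a j - s * b j)"
      by (simp add: algebra_simps)
    then have "norm (a i * b j - b i * a j) \<le> norm (a i - s * b i) * norm (b j) + norm (b i) * norm (a j - s * b j)"
      by (metis norm_mult norm_triangle_ineq4)
    also have "\<dots> \<le> \<epsilon> * norm (b j) + norm (b i) * \<epsilon>"
      using s[OF i] s[OF j(1)] \<open>\<epsilon> > 0\<close> by (intro add_mono mult_mono) auto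
    finally show "norm (a i * b j - b i * a j) \<le> (norm (b j) + norm (b i)) * \<epsilon>"
      by (simp add: algebra_simps)
  qed simp
  have "a i = a j / b j * b i" if "i \<le> e" for i
    using cross[OF that] j(2) by (simp add: field_simps)
  then have eq: "p = (\<lambda>z w. a j / b j * q z w)"
    unfolding a b de by (auto simp: fun_eq_iff sum_distrib_left mult.assoc intro!: sum.cong)
  moreover have "a j / b j \<noteq> 0" using p(2) eq by auto
  ultimately show ?thesis using that by blast
qed

section \<open>Invariance under scaling the generator\<close>

lemma hardy_inner_cmult:
  assumes "finite_expansion F a" "finite_expansion G b"
  shows "hardy_inner (\<lambda>z w. c * F z w) (\<lambda>z w. d * G z w) = c * cnj d * hardy_inner F G"
proof -
  let ?S = "{ij. a ij \<noteq> 0}"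
  have fin: "finite ?S" using assms(1) by (simp add: finite_expansion_def)
  have "hardy_inner (\<lambda>z w. c * F z w) (\<lambda>z w. d * G z w) = (\<Sum>ij\<in>?S. c * a ij * cnj (d * b ij))"
    by (rule hardy_inner_finite_expansion[OF finite_expansion_cmult[OF assms(1)] finite_expansion_cmult[OF assms(2)] fin]) auto
  moreover have "hardy_inner F G = (\<Sum>ij\<in>?S. a ij * cnj (b ij))"
    by (rule hardy_inner_finite_expansion[OF assms fin]) auto
  ultimately show ?thesis by (simp add: sum_distrib_left mult_ac)
qed

lemma circle_measure_cmult:
  assumes "c \<noteq> 0"
  shows "circle_measure (\<lambda>z w. c * p z w) = circle_measure p"
  using assms by (simp add: circle_measure_def norm_mult power_mult_distrib)

lemma finite_expansion_homogenize: "\<exists>a. finite_expansion (homogenize d f) a"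
proof -
  have "homogenize d f = (\<lambda>z w. \<Sum>i\<le>d. coeff f i * z ^ i * w ^ (d - i))"
    by (simp add: fun_eq_iff homogenize_def)
  then show ?thesis using finite_expansion_homogeneous[of "coeff f" d] by auto
qed

context arc_weight
begin

lemma arc_form_neq_0: "arc_form \<noteq> (\<lambda>z w. 0)"
proof
  assume "arc_form = (\<lambda>z w. 0)"
  then have "arc_form 1 0 = 0" by simp
  then show False by (simp add: arc_form_def)
qed

lemma homogeneous2_arc_form: "homogeneous2 2 arc_form"
  unfolding homogeneous2_def arc_form_eq_homogenize homogenize_def[abs_def] by blast

lemma Sigma_gen_cmult_arc_form:
  assumes "c \<noteq> 0"
  shows "Sigma_gen (\<lambda>z w. c * arc_form z w) k = Sigma_gen arc_form k"
proof -
  obtain a where a: "finite_expansion arc_form a"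
    using finite_expansion_homogenize unfolding arc_form_eq_homogenize by blast
  have "Re (hardy_inner (\<lambda>z w. c * arc_form z w) (\<lambda>z w. c * arc_form z w)) = (norm c)\<^sup>2 * Re (hardy_inner arc_form arc_form)"
    unfolding hardy_inner_cmult[OF a a] complex_norm_square[symmetric] by simp
  then have norm: "hardy_norm (\<lambda>z w. c * arc_form z w) = norm c * hardy_norm arc_form"
    by (simp add: hardy_norm_def real_sqrt_mult)
  define u where "u = c / of_real (norm c)"
  have u: "norm u = 1" using assms by (simp add: u_def norm_divide)
  have e: "w ^ k * basis_e (\<lambda>z w. c * arc_form z w) j z w = u * (w ^ k * basis_e arc_form j z w)" for j z w
    by (simp add: basis_e_def norm circle_measure_cmult[OF assms] u_def)
  have f: "z ^ k * basis_f (\<lambda>z w. c * arc_form z w) n z w = u * (z ^ k * basis_f arc_form n z w)" for n z w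
    by (simp add: basis_f_def norm circle_measure_cmult[OF assms] u_def)
  have "norm (hardy_inner (\<lambda>z w. u * (w ^ k * basis_e arc_form j z w)) (\<lambda>z w. u * (z ^ k * basis_f arc_form n z w))) =
        norm (hardy_inner (\<lambda>z w. w ^ k * basis_e arc_form j z w) (\<lambda>z w. z ^ k * basis_f arc_form n z w))" for j n
  proof -
    obtain a b where "finite_expansion (\<lambda>z w. w ^ k * basis_e arc_form j z w) a"
      "finite_expansion (\<lambda>z w. z ^ k * basis_f arc_form n z w) b"
      unfolding basis_e_arc_form basis_f_arc_form using finite_expansion_homogenize by metis
    from hardy_inner_cmult[OF this] show ?thesis by (simp add: norm_mult u)
  qed
  then show ?thesis unfolding Sigma_gen_def e f by simp
qed

lemma Sigma_sub_arc_form: "Sigma_sub (submodule_gen arc_form) k = Sigma_gen arc_form k"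
  unfolding Sigma_sub_def
proof (rule the_equality)
  show "\<exists>d p. homogeneous2 d p \<and> p \<noteq> (\<lambda>z w. 0) \<and> submodule_gen arc_form = submodule_gen p \<and>
      Sigma_gen arc_form k = Sigma_gen p k"
    using homogeneous2_arc_form arc_form_neq_0 by blast
next
  fix s
  assume "\<exists>d p. homogeneous2 d p \<and> p \<noteq> (\<lambda>z w. 0) \<and> submodule_gen arc_form = submodule_gen p \<and> s = Sigma_gen p k"
  then obtain d p where p: "homogeneous2 d p" "p \<noteq> (\<lambda>z w. 0)" "submodule_gen p = submodule_gen arc_form" "s = Sigma_gen p k"
    by auto
  obtain c where "c \<noteq> 0" "p = (\<lambda>z w. c * arc_form z w)"
    by (rule submodule_gen_homogeneous_eq[OF p(1,2) homogeneous2_arc_form arc_form_neq_0 p(3)])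
  then show "s = Sigma_gen arc_form k" using p(4) Sigma_gen_cmult_arc_form by simp
qed

end

theorem theorem8p3:
  shows "Sigma_sub M_star 3 < \<infinity> \<and> Sigma_sub M_star 4 < \<infinity> \<and>
         enn2real (Sigma_sub M_star 4) - enn2real (Sigma_sub M_star 3) > 13 / 75000 \<and>
         (13 / 75000 :: real) > 0 \<and>
         (\<exists>p. homogeneous2 2 p \<and> p \<noteq> (\<lambda>z w. 0) \<and>
              \<not> decseq (\<lambda>k. Sigma_sub (submodule_gen p) k))"
proof -
  define \<sigma> where "\<sigma> = (\<lambda>k. \<Sum>n. (sixth.overlap k (n + 2))\<^sup>2)"
  have nonneg: "\<sigma> k \<ge> 0" for k
    unfolding \<sigma>_def by (rule suminf_nonneg[OF summable_sixth_overlap]) simp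
  have "(\<lambda>z w. z\<^sup>2 - of_real (sqrt 3) * z * w + w\<^sup>2) = sixth.arc_form"
    by (simp add: fun_eq_iff sixth.arc_form_def cos_30)
  then have M: "M_star = submodule_gen sixth.arc_form" by (simp add: M_star_def)
  have Sigma: "Sigma_sub (submodule_gen sixth.arc_form) k = ennreal (\<sigma> k)" if "k \<ge> 1" for k
    unfolding sixth.Sigma_sub_arc_form Sigma_gen_sixth[OF that] \<sigma>_def ..
  have diff: "\<sigma> 4 - \<sigma> 3 \<ge> 2 / 10 ^ 4"
    unfolding \<sigma>_def by (rule Sigma_gen_sixth_diff)
  have "\<not> decseq (\<lambda>k. Sigma_sub (submodule_gen sixth.arc_form) k)"
  proof
    assume "decseq (\<lambda>k. Sigma_sub (submodule_gen sixth.arc_form) k)"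
    then have "Sigma_sub (submodule_gen sixth.arc_form) 4 \<le> Sigma_sub (submodule_gen sixth.arc_form) 3"
      by (rule decseqD) simp
    then show False using diff nonneg[of 3] by (simp add: Sigma ennreal_le_iff)
  qed
  then show ?thesis
    using diff nonneg sixth.homogeneous2_arc_form sixth.arc_form_neq_0
    unfolding M by (auto simp: Sigma)
qed

end
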